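(* Let $(X,\|\cdot\|,\tau)$ be a sequentially complete Saks space with mixed topology $\gamma=\gamma(\|\cdot\|,\tau)$, and put $X_{\gamma}'=(X,\gamma)'$. (a) Let $(X,\gamma)$ be a Mazur space. Then $X^{\circ}\cap B_{\|\cdot\|_{X'}}$ is sequentially complete w.r.t. $\sigma(X^{\circ},X)$ if and only if $(X_{\gamma}',\tau_{\mathrm{c}}(X_{\gamma}',(X,\|\cdot\|)))$ is sequentially complete, where $\tau_{\mathrm{c}}(X_{\gamma}',(X,\|\cdot\|))$ is the topology of uniform convergence on compact subsets of $(X,\|\cdot\|)$. (b) If $(X,\gamma)$ is a $c_{0}$-barrelled Mazur space, then $(X,\|\cdot\|,\tau)$ is d-consistent. In particular, if $(X,\gamma)$ is a Mackey space and a Mazur space, then $(X,\|\cdot\|,\tau)$ is d-consistent.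
   Context: Vector spaces are over $\mathbb{K}=\mathbb{R}$ or $\mathbb{C}$. For a Banach space $(X,\|\cdot\|)$, $X'$ is the norm dual with dual norm $\|\cdot\|_{X'}$ and $B_{\|\cdot\|_{X'}}=\{x'\in X' : \|x'\|_{X'}\le 1\}$. For a Hausdorff locally convex space $(X,\vartheta)$, $(X,\vartheta)'$ is its topological dual. Let $(X,\|\cdot\|)$ be a Banach space and $\tau$ a Hausdorff locally convex topology on $X$ coarser than the norm topology $\tau_{\|\cdot\|}$. The mixed topology $\gamma=\gamma(\|\cdot\|,\tau)$ is the finest linear topology on $X$ that coincides with $\tau$ on $\|\cdot\|$-bounded sets and satisfies $\tau\le\gamma\le\tau_{\|\cdot\|}$ (it is Hausdorff locally convex). $(X,\|\cdot\|,\tau)$ is a Saks space if there is a directed system of seminorms $\mathcal{P}_\tau$ generating $\tau$ with $\|x\|=\sup_{p\in\mathcal{P}_\tau}p(x)$ for all $x\in X$; it is sequentially complete if $(X,\gamma)$ is sequentially complete. $X^{\circ}=\{x'\in X' : x' \text{ is } \tau\text{-sequentially continuous on } \|\cdot\|\text{-bounded sets}\}$. $(X,\|\cdot\|,\tau)$ is d-consistent if (i) $X^{\circ}\cap B_{\|\cdot\|_{X'}}$ is sequentially complete w.r.t. $\sigma(X^{\circ},X)$, and (ii) every $\|\cdot\|_{X'}$-bounded $\sigma(X^{\circ},X)$-null sequence in $X^{\circ}$ is $\tau$-equicontinuous on $\|\cdot\|$-bounded sets (i.e. its restriction to every $\|\cdot\|$-bounded set $B$ is equicontinuous for the topology induced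 by $\tau$ on $B$). A Hausdorff locally convex space $(X,\vartheta)$ is a Mazur space if every linear $\vartheta$-sequentially continuous functional $X\to\mathbb{K}$ is $\vartheta$-continuous; it is $c_0$-barrelled if every $\sigma((X,\vartheta)',X)$-null sequence in $(X,\vartheta)'$ is $\vartheta$-equicontinuous; it is a Mackey space if $\vartheta$ is the Mackey topology $\mu(X,(X,\vartheta)')$. When $(X,\gamma)$ is Mazur one has $X^\circ=(X,\gamma)'$. *)

theory Defs
  imports "HOL-Analysis.Analysis" "HOL-Library.Function_Algebras"
begin

(* The scalar field is a type of sort {real_normed_field, euclidean_space}.  The instances
   real and complex are, up to isometric isomorphism, the only ones: a finite-dimensional
   commutative real division algebra is R or C, and the norm is multiplicative. *)

text \<open>A Banach space over the scalar field: a real Banach space whose real structure is the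
  restriction of a scalar multiplication by \<open>'k\<close> for which the norm is homogeneous.\<close>

locale banach_space_over = vector_space scl
  for scl :: "'k::{real_normed_field,euclidean_space} \<Rightarrow> 'a::banach \<Rightarrow> 'a" +
  assumes norm_scale: "norm (scl c x) = norm c * norm x"
    and scale_of_real: "scl (of_real r) x = r *\<^sub>R x"

definition coarser_topology :: "'a topology \<Rightarrow> 'a topology \<Rightarrow> bool" where
  "coarser_topology S T \<longleftrightarrow> (\<forall>U. openin S U \<longrightarrow> openin T U)"

definition linear_topology ::
  "('k::{real_normed_field,euclidean_space} \<Rightarrow> 'a::ab_group_add \<Rightarrow> 'a) \<Rightarrow> 'a topology \<Rightarrow> bool" where
  "linear_topology scl T \<longleftrightarrow>
     topspace T = UNIV \<and>
     continuous_map (prod_topology T T) T (\<lambda>(x, y). x + y) \<and>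
     continuous_map (prod_topology euclidean T) T (\<lambda>(c, x). scl c x)"

definition hausdorff_lcs ::
  "('k::{real_normed_field,euclidean_space} \<Rightarrow> 'a::real_vector \<Rightarrow> 'a) \<Rightarrow> 'a topology \<Rightarrow> bool" where
  "hausdorff_lcs scl T \<longleftrightarrow>
     linear_topology scl T \<and> Hausdorff_space T \<and>
     (\<forall>U. openin T U \<and> 0 \<in> U \<longrightarrow> (\<exists>V. openin T V \<and> 0 \<in> V \<and> convex V \<and> V \<subseteq> U))"

definition tvs_Cauchy :: "'v::ab_group_add topology \<Rightarrow> (nat \<Rightarrow> 'v) \<Rightarrow> bool" where
  "tvs_Cauchy T s \<longleftrightarrow>
     (\<forall>U. openin T U \<and> 0 \<in> U \<longrightarrow> (\<exists>N. \<forall>m\<ge>N. \<forall>n\<ge>N. s m - s n \<in> U))"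

definition seq_complete_on :: "'v::ab_group_add topology \<Rightarrow> 'v set \<Rightarrow> bool" where
  "seq_complete_on T A \<longleftrightarrow>
     (\<forall>s. range s \<subseteq> A \<and> tvs_Cauchy T s \<longrightarrow> (\<exists>l\<in>A. limitin T s l sequentially))"

definition seq_continuous_map :: "'a topology \<Rightarrow> ('a \<Rightarrow> 'b::topological_space) \<Rightarrow> bool" where
  "seq_continuous_map T f \<longleftrightarrow>
     (\<forall>x l. range x \<subseteq> topspace T \<and> limitin T x l sequentially \<longrightarrow> (\<lambda>n. f (x n)) \<longlonglongrightarrow> f l)"

definition equicontinuous_family :: "'a topology \<Rightarrow> ('a \<Rightarrow> 'b::metric_space) set \<Rightarrow> bool" where
  "equicontinuous_family T F \<longleftrightarrow>
     (\<forall>x\<in>topspace T. \<forall>e>0. \<exists>U. openin T U \<and> x \<in> U \<and> (\<forall>y\<in>U. \<forall>f\<in>F. dist (f y) (f x) < e))"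


subsection \<open>Duals and polar topologies\<close>

text \<open>The norm dual is the case \<open>T = euclidean\<close>; the dual norm is \<^const>\<open>onorm\<close>.\<close>

definition top_dual ::
  "('k::{real_normed_field,euclidean_space} \<Rightarrow> 'a::ab_group_add \<Rightarrow> 'a) \<Rightarrow> 'a topology \<Rightarrow> ('a \<Rightarrow> 'k) set" where
  "top_dual scl T = {f. Vector_Spaces.linear scl (*) f \<and> continuous_map T euclidean f}"

text \<open>\<open>pointwise_topology Y\<close> is the topology \<open>\<sigma>(Y, X)\<close> on a set \<open>Y\<close> of functionals on \<open>X\<close>.\<close>

definition pointwise_topology :: "('a \<Rightarrow> 'k::topological_space) set \<Rightarrow> ('a \<Rightarrow> 'k) topology" where
  "pointwise_topology Y = subtopology (product_topology (\<lambda>_. euclidean) UNIV) Y"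

text \<open>The topology on \<open>Y\<close> of uniform convergence on the members of \<open>\<S>\<close>, for a pairing \<open>b\<close>.
  The condition \<open>\<exists>d<e. \<forall>w\<in>M. \<dots> \<le> d\<close> says that the supremum over \<open>M\<close> exists and is less
  than \<open>e\<close>, also for empty \<open>M\<close>.\<close>

definition uniform_conv_topology ::
  "('v \<Rightarrow> 'w \<Rightarrow> 'k::real_normed_vector) \<Rightarrow> 'v set \<Rightarrow> 'w set set \<Rightarrow> 'v topology" where
  "uniform_conv_topology b Y \<S> =
     topology_generated_by
       {{v \<in> Y. \<exists>d<e. \<forall>w\<in>M. norm (b v w - b u w) \<le> d} | u M e. u \<in> Y \<and> M \<in> \<S> \<and> (e::real) > 0}"

definition compact_conv_topology ::
  "('a::topological_space \<Rightarrow> 'k::real_normed_vector) set \<Rightarrow> ('a \<Rightarrow> 'k) topology" where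
  "compact_conv_topology Y = uniform_conv_topology (\<lambda>f x. f x) Y {K. compact K}"

definition absolutely_convex_functionals :: "('a \<Rightarrow> 'k::real_normed_field) set \<Rightarrow> bool" where
  "absolutely_convex_functionals M \<longleftrightarrow>
     (\<forall>f\<in>M. \<forall>g\<in>M. \<forall>a b. norm a + norm b \<le> 1 \<longrightarrow> (\<lambda>x. a * f x + b * g x) \<in> M)"

text \<open>The Mackey topology \<open>\<mu>(X, Y)\<close>: uniform convergence on the absolutely convex
  \<open>\<sigma>(Y, X)\<close>-compact subsets of \<open>Y\<close>, where \<open>X\<close> acts on \<open>Y\<close> by evaluation.\<close>

definition mackey_topology :: "('a \<Rightarrow> 'k::real_normed_field) set \<Rightarrow> 'a topology" where
  "mackey_topology Y =
     uniform_conv_topology (\<lambda>x f. f x) UNIV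
       {M. absolutely_convex_functionals M \<and> compactin (pointwise_topology Y) M}"


subsection \<open>Classes of locally convex spaces\<close>

definition mazur_space ::
  "('k::{real_normed_field,euclidean_space} \<Rightarrow> 'a::real_vector \<Rightarrow> 'a) \<Rightarrow> 'a topology \<Rightarrow> bool" where
  "mazur_space scl T \<longleftrightarrow>
     hausdorff_lcs scl T \<and>
     (\<forall>f. Vector_Spaces.linear scl (*) f \<and> seq_continuous_map T f \<longrightarrow> continuous_map T euclidean f)"

definition c0_barrelled ::
  "('k::{real_normed_field,euclidean_space} \<Rightarrow> 'a::real_vector \<Rightarrow> 'a) \<Rightarrow> 'a topology \<Rightarrow> bool" where
  "c0_barrelled scl T \<longleftrightarrow>
     hausdorff_lcs scl T \<and>
     (\<forall>f. range f \<subseteq> top_dual scl T \<and>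
          limitin (pointwise_topology (top_dual scl T)) f 0 sequentially \<longrightarrow>
          equicontinuous_family T (range f))"

definition mackey_space ::
  "('k::{real_normed_field,euclidean_space} \<Rightarrow> 'a::real_vector \<Rightarrow> 'a) \<Rightarrow> 'a topology \<Rightarrow> bool" where
  "mackey_space scl T \<longleftrightarrow>
     hausdorff_lcs scl T \<and> T = mackey_topology (top_dual scl T)"


subsection \<open>Saks spaces and the mixed topology\<close>

definition seminorm_over ::
  "('k::real_normed_field \<Rightarrow> 'a::ab_group_add \<Rightarrow> 'a) \<Rightarrow> ('a \<Rightarrow> real) \<Rightarrow> bool" where
  "seminorm_over scl p \<longleftrightarrow>
     (\<forall>x. 0 \<le> p x) \<and> (\<forall>x y. p (x + y) \<le> p x + p y) \<and> (\<forall>c x. p (scl c x) = norm c * p x)"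

definition seminorm_topology :: "('a::ab_group_add \<Rightarrow> real) set \<Rightarrow> 'a topology" where
  "seminorm_topology P = topology_generated_by {{y. p (y - x) < e} | p x e. p \<in> P \<and> e > 0}"

definition directed_seminorms :: "('a \<Rightarrow> real) set \<Rightarrow> bool" where
  "directed_seminorms P \<longleftrightarrow>
     P \<noteq> {} \<and> (\<forall>p\<in>P. \<forall>q\<in>P. \<exists>r\<in>P. \<forall>x. p x \<le> r x \<and> q x \<le> r x)"

definition saks_space ::
  "('k::{real_normed_field,euclidean_space} \<Rightarrow> 'a::banach \<Rightarrow> 'a) \<Rightarrow> 'a topology \<Rightarrow> bool" where
  "saks_space scl \<tau> \<longleftrightarrow>
     banach_space_over scl \<and> hausdorff_lcs scl \<tau> \<and> coarser_topology \<tau> euclidean \<and>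
     (\<exists>P. (\<forall>p\<in>P. seminorm_over scl p) \<and> directed_seminorms P \<and> \<tau> = seminorm_topology P \<and>
          (\<forall>x. bdd_above ((\<lambda>p. p x) ` P) \<and> norm x = (SUP p\<in>P. p x)))"

definition mixed_candidate ::
  "('k::{real_normed_field,euclidean_space} \<Rightarrow> 'a::banach \<Rightarrow> 'a) \<Rightarrow> 'a topology \<Rightarrow> 'a topology \<Rightarrow> bool" where
  "mixed_candidate scl \<tau> \<sigma> \<longleftrightarrow>
     linear_topology scl \<sigma> \<and>
     (\<forall>B. bounded B \<longrightarrow> subtopology \<sigma> B = subtopology \<tau> B) \<and>
     coarser_topology \<tau> \<sigma> \<and> coarser_topology \<sigma> euclidean"

text \<open>\<open>\<gamma>\<close> is the finest candidate.  It exists, as the supremum of all candidates is again one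
  (\<open>\<tau>\<close> itself being a candidate), and it is clearly unique.\<close>

definition is_mixed_topology ::
  "('k::{real_normed_field,euclidean_space} \<Rightarrow> 'a::banach \<Rightarrow> 'a) \<Rightarrow> 'a topology \<Rightarrow> 'a topology \<Rightarrow> bool" where
  "is_mixed_topology scl \<tau> \<gamma> \<longleftrightarrow>
     mixed_candidate scl \<tau> \<gamma> \<and>
     (\<forall>\<sigma>. mixed_candidate scl \<tau> \<sigma> \<longrightarrow> coarser_topology \<sigma> \<gamma>)"

text \<open>\<open>circ_dual scl \<tau>\<close> is \<open>X\<^sup>\<circ>\<close>.\<close>

definition circ_dual ::
  "('k::{real_normed_field,euclidean_space} \<Rightarrow> 'a::banach \<Rightarrow> 'a) \<Rightarrow> 'a topology \<Rightarrow> ('a \<Rightarrow> 'k) set" where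
  "circ_dual scl \<tau> =
     {f \<in> top_dual scl euclidean. \<forall>B. bounded B \<longrightarrow> seq_continuous_map (subtopology \<tau> B) f}"

definition dual_unit_ball ::
  "('k::{real_normed_field,euclidean_space} \<Rightarrow> 'a::banach \<Rightarrow> 'a) \<Rightarrow> ('a \<Rightarrow> 'k) set" where
  "dual_unit_ball scl = {f \<in> top_dual scl euclidean. onorm f \<le> 1}"

definition d_consistent ::
  "('k::{real_normed_field,euclidean_space} \<Rightarrow> 'a::banach \<Rightarrow> 'a) \<Rightarrow> 'a topology \<Rightarrow> bool" where
  "d_consistent scl \<tau> \<longleftrightarrow>
     seq_complete_on (pointwise_topology (circ_dual scl \<tau>))
       (circ_dual scl \<tau> \<inter> dual_unit_ball scl) \<and>
     (\<forall>f. range f \<subseteq> circ_dual scl \<tau> \<and> (\<exists>C. \<forall>n. onorm (f n) \<le> C) \<and>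
          limitin (pointwise_topology (circ_dual scl \<tau>)) f 0 sequentially \<longrightarrow>
          (\<forall>B. bounded B \<longrightarrow> equicontinuous_family (subtopology \<tau> B) (range f)))"

end

theory Submission
  imports Defs
begin

text \<open>
  The proof rests on the fact that \<open>\<gamma>\<close>-convergent sequences are norm bounded
  (\<open>mixed_limit_imp_Bseq\<close>): an unbounded sequence is detected by a seminorm
  \<open>q = (SUP k. p k / (k + 1))\<close> with \<open>p k\<close> from the family that generates \<open>\<tau>\<close> and has the norm as
  supremum, and such a \<open>q\<close> is \<open>\<gamma>\<close>-continuous because \<open>\<gamma>\<close> is the finest linear topology that agrees
  with \<open>\<tau>\<close> on bounded sets.  The members of \<open>X\<^sup>\<circ>\<close> are therefore \<open>\<gamma>\<close>-sequentially continuous,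
  and in a Mazur space \<open>X\<^sup>\<circ>\<close> is the dual of \<open>(X, \<gamma>)\<close> (\<open>circ_dual_eq_mixed_dual\<close>).

  With this identification the equivalence concerns a single subspace \<open>Y\<close> of the norm dual.  A
  sequence in \<open>Y\<close> that is Cauchy for compact convergence is pointwise Cauchy, hence norm bounded by
  the uniform boundedness principle, and a multiple of it lies in the unit ball.  Conversely,
  functionals in the unit ball are uniformly Lipschitz, so that a pointwise Cauchy sequence of them
  is uniformly Cauchy on compact sets (\<open>seq_complete_pointwise_iff_compact_conv\<close>).

  If \<open>(X, \<gamma>)\<close> is moreover \<open>c\<^sub>0\<close>-barrelled, bounded null sequences in the dual are
  \<open>\<gamma>\<close>-equicontinuous, hence \<open>\<tau>\<close>-equicontinuous on bounded sets.  Differences of members of a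
  pointwise Cauchy sequence form null sequences; their equicontinuity makes the pointwise limit
  sequentially continuous (\<open>c0_barrelled_pointwise_limit_seq_continuous\<close>), and the Mazur property
  puts it into the dual.

  Finally, a Mackey-Mazur mixed topology is \<open>c\<^sub>0\<close>-barrelled (\<open>c0_barrelled_if_mackey_mazur\<close>).  For
  a pointwise null sequence \<open>f\<close> in the dual, the set of all \<open>\<Sum>n. a n * f n\<close> with \<open>a\<close> in the unit
  ball of \<open>\<ell>\<^sup>1\<close> is absolutely convex and weakly compact, being a continuous image of a compact
  subset of a product space.  Dominated convergence shows that it consists of sequentially
  continuous functionals, so by the Mazur property it lies in the dual; hence its members, and in
  particular the \<open>f n\<close>, are equicontinuous for the Mackey topology.
\<close>


section \<open>Limits and Cauchy sequences in generated topologies\<close>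

lemma limitin_topology_generated_by:
  "limitin (topology_generated_by S) f l F \<longleftrightarrow>
     l \<in> \<Union>S \<and> (\<forall>U\<in>S. l \<in> U \<longrightarrow> (\<forall>\<^sub>F x in F. f x \<in> U))"
proof
  assume "limitin (topology_generated_by S) f l F"
  then show "l \<in> \<Union>S \<and> (\<forall>U\<in>S. l \<in> U \<longrightarrow> (\<forall>\<^sub>F x in F. f x \<in> U))"
    unfolding limitin_def by (auto intro: topology_generated_by_Basis)
next
  assume R: "l \<in> \<Union>S \<and> (\<forall>U\<in>S. l \<in> U \<longrightarrow> (\<forall>\<^sub>F x in F. f x \<in> U))"
  have "l \<in> U \<longrightarrow> (\<forall>\<^sub>F x in F. f x \<in> U)" if "generate_topology_on S U" for U
    using that
  proof induction
    case (Int a b)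
    then show ?case by (auto intro: eventually_conj)
  next
    case (UN K)
    then show ?case by (blast intro: eventually_mono)
  qed (use R in auto)
  then show "limitin (topology_generated_by S) f l F"
    using R unfolding limitin_def openin_topology_generated_by_iff by simp
qed

text \<open>Differences of a Cauchy sequence tend to \<open>0\<close> along the product filter, so that
  descriptions of limits along arbitrary filters also describe Cauchy sequences.\<close>

lemma tvs_Cauchy_iff_limitin:
  assumes "0 \<in> topspace T"
  shows "tvs_Cauchy T s \<longleftrightarrow> limitin T (\<lambda>(m, n). s m - s n) 0 (sequentially \<times>\<^sub>F sequentially)"
  using assms unfolding tvs_Cauchy_def limitin_def eventually_prod_sequentially by fastforce

lemma limitin_uniform_conv_topology:
  fixes b :: "'v \<Rightarrow> 'w \<Rightarrow> 'k::real_normed_vector"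
  assumes "\<S> \<noteq> {}"
  shows "limitin (uniform_conv_topology b Y \<S>) f l F \<longleftrightarrow>
           l \<in> Y \<and> (\<forall>\<^sub>F n in F. f n \<in> Y) \<and>
           (\<forall>M\<in>\<S>. uniform_limit M (\<lambda>n. b (f n)) (b l) F)"
proof -
  define B where "B u M e = {v \<in> Y. \<exists>d<e. \<forall>w\<in>M. norm (b v w - b u w) \<le> d}" for u M and e :: real
  have top: "uniform_conv_topology b Y \<S> =
      topology_generated_by {B u M e | u M e. u \<in> Y \<and> M \<in> \<S> \<and> e > 0}"
    unfolding uniform_conv_topology_def B_def ..
  have self: "u \<in> B u M e" if "u \<in> Y" "e > 0" for u M e
    using that unfolding B_def by (auto intro!: exI[of _ 0])
  have Union: "\<Union>{B u M e | u M e. u \<in> Y \<and> M \<in> \<S> \<and> e > 0} = Y"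
  proof
    show "Y \<subseteq> \<Union>{B u M e | u M e. u \<in> Y \<and> M \<in> \<S> \<and> e > 0}"
      using self[where e = 1] assms zero_less_one by blast
  qed (auto simp: B_def)
  have "limitin (uniform_conv_topology b Y \<S>) f l F \<longleftrightarrow>
      l \<in> Y \<and> (\<forall>u\<in>Y. \<forall>M\<in>\<S>. \<forall>e>0. l \<in> B u M e \<longrightarrow> (\<forall>\<^sub>F n in F. f n \<in> B u M e))"
    unfolding top limitin_topology_generated_by Union by blast
  also have "\<dots> \<longleftrightarrow> l \<in> Y \<and> (\<forall>\<^sub>F n in F. f n \<in> Y) \<and>
      (\<forall>M\<in>\<S>. uniform_limit M (\<lambda>n. b (f n)) (b l) F)" (is "?L = ?R")
  proof
    assume L: ?L
    have ev: "\<forall>\<^sub>F n in F. f n \<in> B l M e" if "M \<in> \<S>" "e > 0" for M e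
      using L self that by blast
    have "uniform_limit M (\<lambda>n. b (f n)) (b l) F" if "M \<in> \<S>" for M
      unfolding uniform_limit_iff
    proof (intro allI impI)
      fix e :: real assume "e > 0"
      from ev[OF that this] show "\<forall>\<^sub>F n in F. \<forall>x\<in>M. dist (b (f n) x) (b l x) < e"
        by (rule eventually_mono) (auto simp: B_def dist_norm intro: le_less_trans)
    qed
    moreover obtain M where "M \<in> \<S>" using assms by blast
    then have "\<forall>\<^sub>F n in F. f n \<in> Y"
      using ev[of M 1] by (auto simp: B_def elim: eventually_mono)
    ultimately show ?R using L by blast
  next
    assume R: ?R
    show ?L
    proof (intro conjI ballI allI impI)
      fix u M and e :: real
      assume "u \<in> Y" "M \<in> \<S>" "e > 0" "l \<in> B u M e"
      then obtain d where d: "d < e" "\<And>w. w \<in> M \<Longrightarrow> norm (b l w - b u w) \<le> d"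
        unfolding B_def by blast
      \<comment> \<open>The supremum over \<open>M\<close> must stay below \<open>e\<close>, so only half of the gap may be used.\<close>
      have "uniform_limit M (\<lambda>n. b (f n)) (b l) F" using R \<open>M \<in> \<S>\<close> by blast
      moreover have "(e - d) / 2 > 0" using d(1) by simp
      ultimately have "\<forall>\<^sub>F n in F. \<forall>w\<in>M. dist (b (f n) w) (b l w) < (e - d) / 2"
        by (rule uniform_limitD)
      then show "\<forall>\<^sub>F n in F. f n \<in> B u M e"
        using R[THEN conjunct2, THEN conjunct1]
      proof eventually_elim
        case (elim n)
        have "norm (b (f n) w - b u w) \<le> (e + d) / 2" if "w \<in> M" for w
          using elim(1) d(2)[OF that] that
            norm_triangle_ineq[of "b (f n) w - b l w" "b l w - b u w"]
          by (force simp: dist_norm field_simps)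
        moreover have "(e + d) / 2 < e" using d(1) by simp
        ultimately show ?case using elim(2) unfolding B_def by blast
      qed
    qed (use R in blast)
  qed
  finally show ?thesis .
qed

lemma limitin_compact_conv_topology:
  "limitin (compact_conv_topology Y) f l F \<longleftrightarrow>
     l \<in> Y \<and> (\<forall>\<^sub>F n in F. f n \<in> Y) \<and> (\<forall>K. compact K \<longrightarrow> uniform_limit K f l F)"
  unfolding compact_conv_topology_def
  by (subst limitin_uniform_conv_topology) (auto intro: compact_empty)

lemma limitin_pointwise_topology:
  "limitin (pointwise_topology Y) f l F \<longleftrightarrow>
     l \<in> Y \<and> (\<forall>\<^sub>F n in F. f n \<in> Y) \<and> (\<forall>x. ((\<lambda>n. f n x) \<longlongrightarrow> l x) F)"
  unfolding pointwise_topology_def limitin_subtopology limitin_componentwise by auto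

lemma tvs_Cauchy_compact_conv_topology_iff:
  assumes diff: "\<And>f g. f \<in> Y \<Longrightarrow> g \<in> Y \<Longrightarrow> f - g \<in> Y" and "range s \<subseteq> Y"
  shows "tvs_Cauchy (compact_conv_topology Y) s \<longleftrightarrow>
           (\<forall>K. compact K \<longrightarrow> uniformly_Cauchy_on K s)"
proof -
  have s: "s n \<in> Y" for n using assms(2) by auto
  have 0: "0 \<in> Y" using diff[OF s s, of 0 0] by simp
  have "limitin (compact_conv_topology Y) (\<lambda>_. 0) 0 sequentially"
    using 0 unfolding limitin_compact_conv_topology uniform_limit_iff by simp
  then have top: "0 \<in> topspace (compact_conv_topology Y)" by (rule limitin_topspace)
  have "(case w of (m, n) \<Rightarrow> s m - s n) \<in> Y" for w using diff[OF s s] by (cases w) simp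
  then have 1: "tvs_Cauchy (compact_conv_topology Y) s \<longleftrightarrow>
      (\<forall>K. compact K \<longrightarrow> uniform_limit K (\<lambda>(m, n). s m - s n) 0 (sequentially \<times>\<^sub>F sequentially))"
    unfolding tvs_Cauchy_iff_limitin[OF top] limitin_compact_conv_topology using 0 by simp
  have 2: "uniform_limit K (\<lambda>(m, n). s m - s n) 0 (sequentially \<times>\<^sub>F sequentially) \<longleftrightarrow>
      uniformly_Cauchy_on K s" for K
  proof -
    have "dist ((case (n, m) of (m, n) \<Rightarrow> s m - s n) x) (0 x) = dist (s m x) (s n x)" for m n x
      by (simp add: dist_norm norm_minus_commute)
    then show ?thesis
      unfolding uniform_limit_iff uniformly_Cauchy_on_def eventually_prod_sequentially
      by (simp only:) meson
  qed
  show ?thesis unfolding 1 2 ..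
qed

lemma tvs_Cauchy_pointwise_topology_iff:
  fixes s :: "nat \<Rightarrow> 'a \<Rightarrow> 'k::real_normed_vector"
  assumes diff: "\<And>f g. f \<in> Y \<Longrightarrow> g \<in> Y \<Longrightarrow> f - g \<in> Y" and "range s \<subseteq> Y"
  shows "tvs_Cauchy (pointwise_topology Y) s \<longleftrightarrow> (\<forall>x. Cauchy (\<lambda>n. s n x))"
proof -
  have s: "s n \<in> Y" for n using assms(2) by auto
  have 0: "0 \<in> Y" using diff[OF s s, of 0 0] by simp
  have top: "0 \<in> topspace (pointwise_topology Y)"
    using 0 unfolding pointwise_topology_def by simp
  have "(case w of (m, n) \<Rightarrow> s m - s n) \<in> Y" for w using diff[OF s s] by (cases w) simp
  then have 1: "tvs_Cauchy (pointwise_topology Y) s \<longleftrightarrow>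
      (\<forall>x. ((\<lambda>w. (case w of (m, n) \<Rightarrow> s m - s n) x) \<longlongrightarrow> 0) (sequentially \<times>\<^sub>F sequentially))"
    unfolding tvs_Cauchy_iff_limitin[OF top] limitin_pointwise_topology using 0 by simp
  have 2: "((\<lambda>w. (case w of (m, n) \<Rightarrow> s m - s n) x) \<longlongrightarrow> 0) (sequentially \<times>\<^sub>F sequentially) \<longleftrightarrow>
      Cauchy (\<lambda>n. s n x)" for x
  proof -
    have "dist ((case (n, m) of (m, n) \<Rightarrow> s m - s n) x) 0 = dist (s m x) (s n x)" for m n
      by (simp add: dist_norm norm_minus_commute)
    then show ?thesis
      unfolding tendsto_iff Cauchy_def eventually_prod_sequentially by (simp only:)
  qed
  show ?thesis unfolding 1 2 ..
qed

text \<open>A Lipschitz bound common to all members transfers pointwise estimates from a finite net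
  to the whole compact set.\<close>

lemma uniformly_Cauchy_on_compact:
  fixes f :: "nat \<Rightarrow> 'a::metric_space \<Rightarrow> 'b::metric_space"
  assumes "compact K" and Cauchy: "\<And>x. Cauchy (\<lambda>n. f n x)"
    and Lip: "\<And>n x y. dist (f n x) (f n y) \<le> dist x y"
  shows "uniformly_Cauchy_on K f"
  unfolding uniformly_Cauchy_on_def
proof (intro allI impI)
  fix e :: real assume "e > 0"
  then obtain T where T: "finite T" "K \<subseteq> (\<Union>t\<in>T. ball t (e/4))"
    using \<open>compact K\<close> unfolding compact_eq_totally_bounded
    by (metis zero_less_divide_iff zero_less_numeral)
  have "\<forall>t. \<exists>N. \<forall>m\<ge>N. \<forall>n\<ge>N. dist (f m t) (f n t) < e/4"
    using Cauchy \<open>e > 0\<close> unfolding Cauchy_def by (metis zero_less_divide_iff zero_less_numeral)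
  then obtain N where N: "\<And>t m n. m \<ge> N t \<Longrightarrow> n \<ge> N t \<Longrightarrow> dist (f m t) (f n t) < e/4"
    by metis
  have "dist (f m x) (f n x) < e" if "x \<in> K" "m \<ge> Max (N ` T)" "n \<ge> Max (N ` T)" for x m n
  proof -
    obtain t where t: "t \<in> T" "dist t x < e/4" using T(2) \<open>x \<in> K\<close> by auto
    have "Max (N ` T) \<ge> N t" using t(1) T(1) by simp
    then have "m \<ge> N t" "n \<ge> N t" using that by linarith+
    then have "dist (f m t) (f n t) < e/4" by (rule N)
    moreover have "dist (f m x) (f n x) \<le> dist (f m x) (f m t) + dist (f m t) (f n t) + dist (f n t) (f n x)"
      by (meson add_mono dist_triangle order_refl order_trans)
    ultimately show ?thesis
      using Lip[of m x t] Lip[of n t x] t(2) \<open>e > 0\<close> by (simp add: dist_commute)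
  qed
  then show "\<exists>M. \<forall>x\<in>K. \<forall>m\<ge>M. \<forall>n\<ge>M. dist (f m x) (f n x) < e" by blast
qed


section \<open>Continuous functionals\<close>

text \<open>By Baire's theorem one of the closed sets \<open>A k\<close>, on which the sequence is bounded by \<open>k\<close>,
  contains a ball.\<close>

lemma uniform_boundedness_sequence:
  fixes f :: "nat \<Rightarrow> 'a::banach \<Rightarrow> 'b::real_normed_vector"
  assumes lin: "\<And>n. bounded_linear (f n)" and bdd: "\<And>x. Bseq (\<lambda>n. f n x)"
  obtains C where "C > 0" "\<And>n x. norm (f n x) \<le> C * norm x"
proof -
  define A where "A k = {x. \<forall>n. norm (f n x) \<le> real k}" for k :: nat
  have "closed (A k)" for k
  proof -
    have "A k = (\<Inter>n. {x. norm (f n x) \<le> real k})" unfolding A_def by auto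
    then show ?thesis
      using lin by (simp add: closed_INT closed_Collect_le continuous_on_norm linear_continuous_on)
  qed
  moreover have "(\<Union>k. A k) = UNIV"
  proof -
    have "\<exists>k. x \<in> A k" for x
    proof -
      obtain K where "\<And>n. norm (f n x) \<le> K" using bdd[of x] unfolding Bseq_def by blast
      moreover obtain k where "K \<le> real k" using real_arch_simple by blast
      ultimately show ?thesis unfolding A_def using order_trans by blast
    qed
    then show ?thesis by blast
  qed
  ultimately obtain k where "interior (A k) \<noteq> {}"
    using Baire_category_alt[of "euclidean :: 'a topology" "range A"]
      completely_metrizable_space_euclidean by fastforce
  then obtain x0 where "x0 \<in> interior (A k)" by blast
  then obtain r where r: "r > 0" "cball x0 r \<subseteq> A k"
    unfolding mem_interior_cball by blast
  have "norm (f n x) \<le> (2 * k / r + 1) * norm x" for n x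
  proof (cases "x = 0")
    case True
    then show ?thesis using lin by (simp add: linear_simps)
  next
    case False
    interpret bounded_linear "f n" by (rule lin)
    define y where "y = (r / norm x) *\<^sub>R x"
    have "norm y = r" using False r(1) by (simp add: y_def)
    then have "x0 + y \<in> A k" "x0 \<in> A k" using r by (auto simp: subset_iff dist_norm)
    then have "norm (f n (x0 + y)) \<le> k" "norm (f n x0) \<le> k" unfolding A_def by auto
    moreover have "f n y = f n (x0 + y) - f n x0" by (simp add: add)
    ultimately have "norm (f n y) \<le> 2 * k"
      using norm_triangle_ineq4[of "f n (x0 + y)" "f n x0"] by simp
    then have "norm (f n x) \<le> (2 * k / r) * norm x"
      using False r(1) by (simp add: y_def scaleR field_simps)
    then show ?thesis by (simp add: distrib_right add_increasing2)
  qed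
  moreover have "2 * k / r + 1 > 0" using r(1) by (simp add: add_nonneg_pos)
  ultimately show ?thesis using that by blast
qed

lemma top_dual_diff:
  fixes scl :: "'k::{real_normed_field,euclidean_space} \<Rightarrow> 'a::banach \<Rightarrow> 'a"
  assumes "f \<in> top_dual scl T" "g \<in> top_dual scl T"
  shows "f - g \<in> top_dual scl T"
proof -
  have "Vector_Spaces.linear scl (*) (f - g)"
    using assms unfolding top_dual_def Vector_Spaces.linear_iff by (simp add: algebra_simps)
  moreover have "continuous_map T euclidean (f - g)"
    using assms continuous_map_diff[of T f g] unfolding top_dual_def fun_diff_def by simp
  ultimately show ?thesis unfolding top_dual_def by simp
qed

lemma top_dual_mult:
  fixes scl :: "'k::{real_normed_field,euclidean_space} \<Rightarrow> 'a::banach \<Rightarrow> 'a"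
  assumes "f \<in> top_dual scl T"
  shows "(\<lambda>x. c * f x) \<in> top_dual scl T"
proof -
  have "Vector_Spaces.linear scl (*) (\<lambda>x. c * f x)"
    using assms unfolding top_dual_def Vector_Spaces.linear_iff by (simp add: algebra_simps)
  moreover have "continuous_map T euclidean (\<lambda>x. c * f x)"
  proof -
    have "continuous_map T euclidean ((\<lambda>y. c * y) \<circ> f)"
      using assms unfolding top_dual_def
      by (intro continuous_map_compose[where X' = euclidean]) (auto intro!: continuous_intros)
    then show ?thesis by (simp add: o_def)
  qed
  ultimately show ?thesis unfolding top_dual_def by simp
qed

context banach_space_over
begin

lemma functional_imp_linear:
  assumes "Vector_Spaces.linear scl (*) f" shows "linear f"
proof (rule linearI)
  fix r :: real and x
  have "f (r *\<^sub>R x) = f (scl (of_real r) x)" by (simp add: scale_of_real)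
  also have "\<dots> = r *\<^sub>R f x" using assms by (simp add: Vector_Spaces.linear_iff scaleR_conv_of_real)
  finally show "f (r *\<^sub>R x) = r *\<^sub>R f x" .
qed (use assms in \<open>simp add: Vector_Spaces.linear_iff\<close>)

lemma norm_dual_imp_bounded_linear:
  assumes "f \<in> top_dual scl euclidean" shows "bounded_linear f"
proof -
  have "linear f" "isCont f 0"
    using assms functional_imp_linear unfolding top_dual_def
    by (auto simp: continuous_on_eq_continuous_at)
  then interpret linear f by simp
  obtain d where d: "d > 0" "\<And>x. norm x < d \<Longrightarrow> norm (f x) < 1"
    using \<open>isCont f 0\<close> unfolding continuous_at_eps_delta
    by (auto simp: zero dest!: spec[of _ "1::real"])
  have "norm (f x) \<le> norm x * (2 / d)" for x
  proof (cases "x = 0")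
    case False
    have "norm (f ((d / (2 * norm x)) *\<^sub>R x)) < 1" using False d(1) by (intro d(2)) simp
    then show ?thesis using False d(1) by (simp add: scale field_simps)
  qed (simp add: zero)
  then show ?thesis by (intro bounded_linear_intro[of f "2/d"]) (auto simp: add scale)
qed

lemma pointwise_limit_norm_dual:
  assumes "\<And>n. f n \<in> top_dual scl euclidean" and "\<And>n x. norm (f n x) \<le> C * norm x"
    and lim: "\<And>x. (\<lambda>n. f n x) \<longlonglongrightarrow> g x"
  shows "g \<in> top_dual scl euclidean" and "norm (g x) \<le> C * norm x"
proof -
  have lin: "Vector_Spaces.linear scl (*) (f n)" for n using assms(1) unfolding top_dual_def by simp
  have "g (x + y) = g x + g y" for x y
    using LIMSEQ_unique[OF lim[of "x + y"]] tendsto_add[OF lim[of x] lim[of y]] lin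
    by (simp add: Vector_Spaces.linear_iff)
  moreover have "g (scl c x) = c * g x" for c x
    using LIMSEQ_unique[OF lim[of "scl c x"]] tendsto_mult[OF tendsto_const[of c] lim[of x]] lin
    by (simp add: Vector_Spaces.linear_iff)
  ultimately have g: "Vector_Spaces.linear scl (*) g"
    using lin[of 0] by (simp add: Vector_Spaces.linear_iff)
  show bound: "norm (g x) \<le> C * norm x" for x
    by (rule Lim_bounded[OF tendsto_norm[OF lim]]) (use assms(2) in auto)
  have "bounded_linear g"
    using functional_imp_linear[OF g] bound
    by (intro bounded_linear_intro[of g C]) (auto simp: linear_add linear_scale mult.commute)
  then show "g \<in> top_dual scl euclidean"
    using g linear_continuous_on unfolding top_dual_def by auto
qed

lemma norm_le_of_dual_unit_ball:
  assumes "f \<in> dual_unit_ball scl" shows "norm (f x) \<le> norm x"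
proof -
  have "norm (f x) \<le> onorm f * norm x"
    using assms unfolding dual_unit_ball_def by (auto intro: onorm norm_dual_imp_bounded_linear)
  also have "\<dots> \<le> 1 * norm x"
    using assms unfolding dual_unit_ball_def by (intro mult_right_mono) auto
  finally show ?thesis by simp
qed

lemma dual_unit_ballI:
  assumes "f \<in> top_dual scl euclidean" "\<And>x. norm (f x) \<le> norm x"
  shows "f \<in> dual_unit_ball scl"
  using assms onorm_bound[of 1 f] unfolding dual_unit_ball_def by simp

end


section \<open>Topologies generated by seminorms\<close>

lemma openin_seminorm_topology_ball:
  assumes "p \<in> P" "e > 0"
  shows "openin (seminorm_topology P) {y. p (y - x) < e}"
  unfolding seminorm_topology_def using assms by (intro topology_generated_by_Basis) blast

lemma coarser_topology_iff_continuous_map_id: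
  assumes "topspace S = UNIV" "topspace T = UNIV"
  shows "coarser_topology S T \<longleftrightarrow> continuous_map T S id"
  using assms unfolding coarser_topology_def continuous_map_def by simp

context banach_space_over
begin

lemma seminorm_zero: "seminorm_over scl p \<Longrightarrow> p 0 = 0"
  unfolding seminorm_over_def by (metis mult_zero_left norm_zero scale_zero_left)

lemma seminorm_triangle:
  assumes "seminorm_over scl p" shows "p (x + y) \<le> p x + p y"
  using assms unfolding seminorm_over_def by blast

lemma topspace_seminorm_topology:
  assumes "Q \<noteq> {}" "\<And>p. p \<in> Q \<Longrightarrow> seminorm_over scl p"
  shows "topspace (seminorm_topology Q) = UNIV"
proof -
  obtain p where "p \<in> Q" using assms(1) by blast
  have "x \<in> topspace (seminorm_topology Q)" for x
  proof -
    have "x \<in> {y. p (y - x) < 1}" using seminorm_zero[OF assms(2)[OF \<open>p \<in> Q\<close>]] by simp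
    moreover have "openin (seminorm_topology Q) {y. p (y - x) < 1}"
      using \<open>p \<in> Q\<close> by (intro openin_seminorm_topology_ball) auto
    ultimately show ?thesis using openin_subset by blast
  qed
  then show ?thesis by blast
qed

lemma continuous_map_into_seminorm_topology:
  assumes "Q \<noteq> {}" and semi: "\<And>p. p \<in> Q \<Longrightarrow> seminorm_over scl p"
    and small: "\<And>p z e. p \<in> Q \<Longrightarrow> z \<in> topspace S \<Longrightarrow> e > 0 \<Longrightarrow>
                  \<exists>W. openin S W \<and> z \<in> W \<and> (\<forall>w\<in>W. p (f w - f z) < e)"
  shows "continuous_map S (seminorm_topology Q) f"
proof -
  have "openin S (f -` U \<inter> topspace S)"
    if U: "U \<in> {{y. p (y - x) < e} | p x e. p \<in> Q \<and> e > 0}" for U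
  proof -
    from U obtain p a e where p: "p \<in> Q" "U = {y. p (y - a) < e}" by blast
    have "\<exists>W. openin S W \<and> z \<in> W \<and> W \<subseteq> f -` U \<inter> topspace S"
      if z: "z \<in> f -` U \<inter> topspace S" for z
    proof -
      have "p (f z - a) < e" using z p(2) by simp
      then obtain W where W: "openin S W" "z \<in> W" "\<And>w. w \<in> W \<Longrightarrow> p (f w - f z) < e - p (f z - a)"
        using small[OF p(1), of z "e - p (f z - a)"] z by auto
      have "p (f w - a) < e" if "w \<in> W" for w
        using W(3)[OF that] seminorm_triangle[OF semi[OF p(1)], of "f w - f z" "f z - a"] by simp
      then show ?thesis using W p(2) openin_subset[OF W(1)] by blast
    qed
    then show ?thesis by (subst openin_subopen) blast
  qed
  moreover have "\<Union>{{y. p (y - x) < e} | p x e. p \<in> Q \<and> e > 0} = UNIV"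
    using topspace_seminorm_topology[OF assms(1) semi]
    unfolding seminorm_topology_def topology_generated_by_topspace by simp
  ultimately show ?thesis
    unfolding seminorm_topology_def by (intro continuous_on_generated_topo) auto
qed

lemma linear_topology_seminorm_topology:
  assumes "Q \<noteq> {}" and semi: "\<And>p. p \<in> Q \<Longrightarrow> seminorm_over scl p"
  shows "linear_topology scl (seminorm_topology Q)" (is "linear_topology scl ?T")
  unfolding linear_topology_def
proof (intro conjI)
  show top: "topspace ?T = UNIV" using assms by (rule topspace_seminorm_topology)
  show "continuous_map (prod_topology ?T ?T) ?T (\<lambda>(x, y). x + y)"
  proof (rule continuous_map_into_seminorm_topology[OF assms])
    fix p and z :: "'a \<times> 'a" and e :: real assume p: "p \<in> Q" "e > 0"
    obtain x0 y0 where z: "z = (x0, y0)" by force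
    let ?A = "{x. p (x - x0) < e/2}" and ?B = "{y. p (y - y0) < e/2}"
    have "openin (prod_topology ?T ?T) (?A \<times> ?B)"
      unfolding openin_prod_Times_iff
      using openin_seminorm_topology_ball[OF p(1) half_gt_zero[OF p(2)]] by blast
    moreover have "z \<in> ?A \<times> ?B" using z p seminorm_zero[OF semi[OF p(1)]] by simp
    moreover have "p ((x + y) - (x0 + y0)) < e" if "x \<in> ?A" "y \<in> ?B" for x y
      using seminorm_triangle[OF semi[OF p(1)], of "x - x0" "y - y0"] that
      by (simp add: algebra_simps)
    ultimately show "\<exists>W. openin (prod_topology ?T ?T) W \<and> z \<in> W \<and>
        (\<forall>w\<in>W. p ((case w of (x, y) \<Rightarrow> x + y) - (case z of (x, y) \<Rightarrow> x + y)) < e)"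
      using z by (intro exI[of _ "?A \<times> ?B"]) auto
  qed
  show "continuous_map (prod_topology euclidean ?T) ?T (\<lambda>(c, x). scl c x)"
  proof (rule continuous_map_into_seminorm_topology[OF assms])
    fix p and z :: "'k \<times> 'a" and e :: real assume p: "p \<in> Q" "e > 0"
    obtain c0 x0 where z: "z = (c0, x0)" by force
    have nonneg: "p x \<ge> 0" for x using semi[OF p(1)] unfolding seminorm_over_def by blast
    \<comment> \<open>From \<open>c x - c0 x0 = c (x - x0) + (c - c0) x0\<close>, with \<open>norm c \<le> norm c0 + 1\<close>.\<close>
    define d1 where "d1 = min 1 (e / 2 / (p x0 + 1))"
    define d2 where "d2 = e / 2 / (norm c0 + 1)"
    have d: "d1 > 0" "d2 > 0" unfolding d1_def d2_def using p(2) nonneg[of x0]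
      by (auto intro!: divide_pos_pos add_nonneg_pos)
    let ?A = "ball c0 d1" and ?B = "{x. p (x - x0) < d2}"
    have "openin (prod_topology euclidean ?T) (?A \<times> ?B)"
      using p d by (simp add: openin_prod_Times_iff openin_seminorm_topology_ball)
    moreover have "z \<in> ?A \<times> ?B" using z d seminorm_zero[OF semi[OF p(1)]] by simp
    moreover have "p (scl c x - scl c0 x0) < e" if "c \<in> ?A" "x \<in> ?B" for c x
    proof -
      have c: "norm (c - c0) < d1" using that(1) by (simp add: dist_norm norm_minus_commute)
      then have "norm c \<le> norm c0 + 1"
        using norm_triangle_ineq2[of c c0] unfolding d1_def by simp
      then have "norm c * p (x - x0) \<le> (norm c0 + 1) * p (x - x0)"
        using nonneg by (rule mult_right_mono)
      also have "\<dots> < (norm c0 + 1) * d2"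
        using that(2) by (intro mult_strict_left_mono) (auto intro: add_nonneg_pos)
      also have "\<dots> = e / 2"
      proof -
        have "norm c0 + 1 \<noteq> 0" using norm_ge_zero[of c0] by linarith
        then show ?thesis unfolding d2_def by (metis mult.commute nonzero_eq_divide_eq)
      qed
      finally have 1: "norm c * p (x - x0) < e / 2" .
      have "norm (c - c0) * p x0 \<le> (e / 2 / (p x0 + 1)) * p x0"
        using c nonneg[of x0] unfolding d1_def by (intro mult_right_mono) auto
      also have "\<dots> \<le> e / 2" using p(2) nonneg[of x0] by (simp add: field_simps)
      finally have 2: "norm (c - c0) * p x0 \<le> e / 2" .
      have "p (scl c x - scl c0 x0) = p (scl c (x - x0) + scl (c - c0) x0)"
        by (simp add: algebra_simps)
      also have "\<dots> \<le> norm c * p (x - x0) + norm (c - c0) * p x0"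
        using semi[OF p(1)] unfolding seminorm_over_def by metis
      finally show ?thesis using 1 2 by simp
    qed
    ultimately show "\<exists>W. openin (prod_topology euclidean ?T) W \<and> z \<in> W \<and>
        (\<forall>w\<in>W. p ((case w of (c, x) \<Rightarrow> scl c x) - (case z of (c, x) \<Rightarrow> scl c x)) < e)"
      using z by (intro exI[of _ "?A \<times> ?B"]) auto
  qed
qed


section \<open>Convergent sequences of the mixed topology\<close>

text \<open>Adding to a generating family of \<open>\<tau>\<close> a seminorm that is dominated by the norm and
  \<open>\<tau>\<close>-continuous on bounded sets gives another linear topology that agrees with \<open>\<tau>\<close> on
  bounded sets.  By maximality it is coarser than \<open>\<gamma>\<close>.\<close>

lemma mixed_topology_seminorm_ball_open:
  assumes mixed: "is_mixed_topology scl (seminorm_topology P) \<gamma>"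
    and "P \<noteq> {}" and semi: "\<And>p. p \<in> P \<Longrightarrow> seminorm_over scl p"
    and le: "\<And>p x. p \<in> P \<Longrightarrow> p x \<le> norm x"
    and q: "seminorm_over scl q" and q_le: "\<And>x. q x \<le> norm x"
    and q_loc: "\<And>y R e. e > 0 \<Longrightarrow> \<exists>U. openin (seminorm_topology P) U \<and> y \<in> U \<and>
                  (\<forall>z\<in>U. norm (z - y) \<le> R \<longrightarrow> q (z - y) < e)"
    and "e > 0"
  shows "openin \<gamma> {y. q (y - x) < e}"
proof -
  let ?\<tau> = "seminorm_topology P" and ?\<sigma> = "seminorm_topology (insert q P)"
  have semi': "\<And>p. p \<in> insert q P \<Longrightarrow> seminorm_over scl p" using semi q by auto
  have le': "\<And>p x. p \<in> insert q P \<Longrightarrow> p x \<le> norm x" using le q_le by auto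
  have top: "topspace ?\<tau> = UNIV" "topspace ?\<sigma> = UNIV"
    using topspace_seminorm_topology[OF \<open>P \<noteq> {}\<close> semi] topspace_seminorm_topology[OF insert_not_empty semi'] by auto
  have \<tau>\<sigma>: "coarser_topology ?\<tau> ?\<sigma>"
    unfolding coarser_topology_iff_continuous_map_id[OF top]
  proof (rule continuous_map_into_seminorm_topology[OF \<open>P \<noteq> {}\<close> semi], assumption)
    fix p z and e :: real assume p: "p \<in> P" "e > 0"
    then show "\<exists>W. openin ?\<sigma> W \<and> z \<in> W \<and> (\<forall>w\<in>W. p (id w - id z) < e)"
      using seminorm_zero[OF semi[OF p(1)]]
      by (intro exI[of _ "{w. p (w - z) < e}"]) (auto intro: openin_seminorm_topology_ball)
  qed
  have "coarser_topology ?\<sigma> euclidean"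
    unfolding coarser_topology_iff_continuous_map_id[OF top(2) topspace_euclidean]
  proof (rule continuous_map_into_seminorm_topology[OF _ semi'])
    fix p z and e :: real assume p: "p \<in> insert q P" "e > 0"
    have "p (w - z) < e" if "w \<in> ball z e" for w
      using le'[OF p(1), of "w - z"] that by (simp add: dist_norm norm_minus_commute)
    then show "\<exists>W. openin euclidean W \<and> z \<in> W \<and> (\<forall>w\<in>W. p (id w - id z) < e)"
      using \<open>e > 0\<close> by (intro exI[of _ "ball z e"]) auto
  qed auto
  moreover have "subtopology ?\<sigma> B = subtopology ?\<tau> B" if "bounded B" for B
  proof -
    obtain R where R: "\<And>x. x \<in> B \<Longrightarrow> norm x \<le> R" using \<open>bounded B\<close> unfolding bounded_iff by blast
    have "continuous_map (subtopology ?\<tau> B) ?\<sigma> id"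
    proof (rule continuous_map_into_seminorm_topology[OF _ semi'])
      fix p z and e :: real
      assume p: "p \<in> insert q P" "e > 0" and "z \<in> topspace (subtopology ?\<tau> B)"
      then have "z \<in> B" by simp
      have "\<exists>U. openin ?\<tau> U \<and> z \<in> U \<and> (\<forall>w\<in>U \<inter> B. p (w - z) < e)"
      proof (cases "p = q")
        case True
        have "norm (w - z) \<le> 2 * R" if "w \<in> B" for w
          using R[OF that] R[OF \<open>z \<in> B\<close>] norm_triangle_ineq4[of w z] by simp
        then show ?thesis using q_loc[OF \<open>e > 0\<close>, of z "2 * R"] True by blast
      next
        case False
        then have "p \<in> P" using p(1) by simp
        then show ?thesis
          using p(2) seminorm_zero[OF semi[OF \<open>p \<in> P\<close>]]
          by (intro exI[of _ "{w. p (w - z) < e}"]) (auto intro: openin_seminorm_topology_ball)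
      qed
      then obtain U where "openin ?\<tau> U" "z \<in> U" "\<forall>w\<in>U \<inter> B. p (w - z) < e" by blast
      then show "\<exists>W. openin (subtopology ?\<tau> B) W \<and> z \<in> W \<and> (\<forall>w\<in>W. p (id w - id z) < e)"
        using \<open>z \<in> B\<close> by (intro exI[of _ "U \<inter> B"]) (auto simp: openin_subtopology)
    qed auto
    then have pre: "openin (subtopology ?\<tau> B) (U \<inter> B)" if "openin ?\<sigma> U" for U
      using openin_continuous_map_preimage[OF _ that, of "subtopology ?\<tau> B" id] top
      by (simp add: Collect_conj_eq Int_commute)
    show ?thesis
      unfolding topology_eq
    proof (intro allI iffI)
      fix V assume "openin (subtopology ?\<sigma> B) V"
      then show "openin (subtopology ?\<tau> B) V"
        unfolding openin_subtopology[of ?\<sigma>] using pre by blast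
    next
      fix V assume "openin (subtopology ?\<tau> B) V"
      then show "openin (subtopology ?\<sigma> B) V"
        using \<tau>\<sigma> unfolding openin_subtopology coarser_topology_def by blast
    qed
  qed
  ultimately have "mixed_candidate scl ?\<tau> ?\<sigma>"
    using \<tau>\<sigma> linear_topology_seminorm_topology[OF insert_not_empty semi'] unfolding mixed_candidate_def by blast
  then have "coarser_topology ?\<sigma> \<gamma>" using mixed unfolding is_mixed_topology_def by blast
  then show ?thesis
    using openin_seminorm_topology_ball[of q "insert q P" e x] \<open>e > 0\<close>
    unfolding coarser_topology_def by simp
qed

end

text \<open>If \<open>x\<close> were unbounded, then for each \<open>k\<close> there would be an index \<open>n \<ge> k\<close> and a seminorm
  \<open>p k\<close> of the family with \<open>p k (x n - l) > k + 1\<close>.  The weights \<open>1 / (k + 1)\<close> tend to \<open>0\<close>, so that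
  on bounded sets only finitely many terms of \<open>q = (SUP k. p k / (k + 1))\<close> matter and \<open>q\<close> is
  \<open>\<gamma>\<close>-continuous; but \<open>q (x n - l) > 1\<close> infinitely often.\<close>

lemma mixed_limit_imp_Bseq:
  fixes scl :: "'k::{real_normed_field,euclidean_space} \<Rightarrow> 'a::banach \<Rightarrow> 'a"
  assumes "saks_space scl \<tau>" and "is_mixed_topology scl \<tau> \<gamma>"
    and lim: "limitin \<gamma> x l sequentially"
  shows "Bseq x"
proof (rule ccontr)
  assume unbounded: "\<not> Bseq x"
  obtain P where "P \<noteq> {}" and semi: "\<And>p. p \<in> P \<Longrightarrow> seminorm_over scl p"
    and \<tau>: "\<tau> = seminorm_topology P"
    and bdd: "\<And>x. bdd_above ((\<lambda>p. p x) ` P)" and norm: "\<And>x. norm x = (SUP p\<in>P. p x)"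
    using assms(1) unfolding saks_space_def directed_seminorms_def by metis
  interpret banach_space_over scl using assms(1) unfolding saks_space_def by blast
  have le: "p z \<le> norm z" if "p \<in> P" for p z
    unfolding norm using that bdd by (intro cSUP_upper)
  have "\<exists>n p. n \<ge> k \<and> p \<in> P \<and> p (x n - l) > real (Suc k)" for k
  proof -
    have "\<not> Bseq (\<lambda>n. x n - l)" using unbounded Bseq_add_iff[of x "-l"] by simp
    then have "\<not> Bseq (\<lambda>n. x (n + k) - l)" using Bseq_offset[of "\<lambda>n. x n - l" k] by blast
    then obtain n where "norm (x (n + k) - l) > real (Suc k)"
      unfolding Bseq_def by (metis not_le of_nat_0_less_iff zero_less_Suc)
    then obtain p where "p \<in> P" "p (x (n + k) - l) > real (Suc k)"
      unfolding norm using less_cSUP_iff[OF \<open>P \<noteq> {}\<close> bdd] by blast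
    then show ?thesis by (intro exI[of _ "n + k"] exI[of _ p]) simp
  qed
  then obtain N p where N: "\<And>k. N k \<ge> k" "\<And>k. p k \<in> P" "\<And>k. p k (x (N k) - l) > real (Suc k)"
    by metis
  have p: "seminorm_over scl (p k)" for k using semi N(2) .
  have p_nonneg: "p k z \<ge> 0" for k z using p unfolding seminorm_over_def by blast
  define q where "q z = (SUP k. p k z / real (Suc k))" for z
  have term_le: "p k z / real (Suc k) \<le> norm z" for k z
  proof -
    have "p k z / real (Suc k) \<le> p k z / 1" using p_nonneg by (intro divide_left_mono) auto
    then show ?thesis using le[OF N(2)[of k], of z] by simp
  qed
  then have bdd_q: "bdd_above (range (\<lambda>k. p k z / real (Suc k)))" for z by (rule bdd_aboveI2)
  have term_le_q: "p k z / real (Suc k) \<le> q z" for k z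
    unfolding q_def using bdd_q by (intro cSUP_upper) auto
  have q_leI: "q z \<le> c" if "\<And>k. p k z / real (Suc k) \<le> c" for z c
    unfolding q_def using that by (intro cSUP_least) auto
  have q_scale_le: "q (scl c z) \<le> norm c * q z" for c z
  proof (rule q_leI)
    fix k
    have "p k (scl c z) / real (Suc k) = norm c * (p k z / real (Suc k))"
      using p[of k] unfolding seminorm_over_def by simp
    also have "\<dots> \<le> norm c * q z" using term_le_q by (intro mult_left_mono) auto
    finally show "p k (scl c z) / real (Suc k) \<le> norm c * q z" .
  qed
  have q: "seminorm_over scl q"
    unfolding seminorm_over_def
  proof (intro conjI allI)
    fix z show "0 \<le> q z" using term_le_q[of 0 z] p_nonneg[of 0 z] by simp
  next
    fix y z
    show "q (y + z) \<le> q y + q z"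
    proof (rule q_leI)
      fix k
      have "p k (y + z) / real (Suc k) \<le> (p k y + p k z) / real (Suc k)"
        using seminorm_triangle[OF p] by (intro divide_right_mono) auto
      then show "p k (y + z) / real (Suc k) \<le> q y + q z"
        using term_le_q[of k y] term_le_q[of k z] by (simp add: add_divide_distrib)
    qed
  next
    fix c z
    show "q (scl c z) = norm c * q z"
    proof (cases "c = 0")
      case True
      have "q 0 \<le> 0" using seminorm_zero[OF p] by (intro q_leI) simp
      moreover have "q 0 \<ge> 0" using term_le_q[of 0 0] p_nonneg[of 0 0] by simp
      ultimately show ?thesis using True by simp
    next
      case False
      have "q z \<le> norm (inverse c) * q (scl c z)"
        using q_scale_le[of "inverse c" "scl c z"] False by simp
      then have "norm c * q z \<le> q (scl c z)"
        using False unfolding norm_inverse by (simp add: field_simps)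
      then show ?thesis using q_scale_le[of c z] by simp
    qed
  qed
  have q_loc: "\<exists>U. openin (seminorm_topology P) U \<and> y \<in> U \<and>
      (\<forall>z\<in>U. norm (z - y) \<le> R \<longrightarrow> q (z - y) < e)" if "e > 0" for y R and e :: real
  proof -
    obtain K :: nat where K: "2 * R / e \<le> real K" using real_arch_simple by blast
    define U where "U = (\<Inter>k\<le>K. {z. p k (z - y) < e / 2})"
    have "openin (seminorm_topology P) U"
      unfolding U_def using N(2) \<open>e > 0\<close>
      by (intro openin_INT2 openin_seminorm_topology_ball) auto
    moreover have "y \<in> U" unfolding U_def using seminorm_zero[OF p] \<open>e > 0\<close> by simp
    moreover have "q (z - y) < e" if "z \<in> U" "norm (z - y) \<le> R" for z
    proof -
      have "p k (z - y) / real (Suc k) \<le> e / 2" for k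
      proof (cases "k \<le> K")
        case True
        have "p k (z - y) / real (Suc k) \<le> p k (z - y) / 1"
          using p_nonneg by (intro divide_left_mono) auto
        also have "p k (z - y) / 1 < e / 2" using \<open>z \<in> U\<close> True unfolding U_def div_by_1 by blast
        finally show ?thesis by (rule less_imp_le)
      next
        case False
        then have "2 * R / e \<le> real (Suc k)" using K by simp
        then have "R \<le> e / 2 * real (Suc k)" using \<open>e > 0\<close> by (simp add: field_simps)
        moreover have "p k (z - y) \<le> R" using le[OF N(2), of k "z - y"] that(2) by simp
        ultimately have "p k (z - y) \<le> e / 2 * real (Suc k)" by linarith
        then show ?thesis by (simp add: pos_divide_le_eq del: of_nat_Suc)
      qed
      then have "q (z - y) \<le> e / 2" by (rule q_leI)
      then show ?thesis using \<open>e > 0\<close> by simp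
    qed
    ultimately show ?thesis by blast
  qed
  have "q z \<le> norm z" for z using term_le by (rule q_leI)
  then have "openin \<gamma> {y. q (y - l) < 1}"
    using assms(2) \<open>P \<noteq> {}\<close> semi le q q_loc unfolding \<tau>
    by (intro mixed_topology_seminorm_ball_open[where P = P]) auto
  moreover have "l \<in> {y. q (y - l) < 1}" using seminorm_zero[OF q] by simp
  ultimately have "\<forall>\<^sub>F n in sequentially. x n \<in> {y. q (y - l) < 1}"
    using lim unfolding limitin_def by blast
  then obtain M where "\<And>n. n \<ge> M \<Longrightarrow> q (x n - l) < 1" unfolding eventually_sequentially by auto
  then have "q (x (N M) - l) < 1" using N(1) by blast
  moreover have "p M (x (N M) - l) / real (Suc M) > 1"
    using N(3)[of M] by (simp add: pos_less_divide_eq del: of_nat_Suc)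
  ultimately show False using term_le_q[of M "x (N M) - l"] by linarith
qed


section \<open>The dual of a Mazur mixed topology\<close>

lemma top_dual_antimono:
  assumes "coarser_topology S T" "topspace S = topspace T"
  shows "top_dual scl S \<subseteq> top_dual scl T"
  using assms unfolding top_dual_def coarser_topology_def continuous_map_def by auto

lemma mixed_topologyD:
  assumes "is_mixed_topology scl \<tau> \<gamma>"
  shows "topspace \<gamma> = UNIV" and "bounded B \<Longrightarrow> subtopology \<tau> B = subtopology \<gamma> B"
    and "top_dual scl \<gamma> \<subseteq> top_dual scl euclidean"
proof -
  have "coarser_topology \<gamma> euclidean" and top: "topspace \<gamma> = UNIV"
    using assms unfolding is_mixed_topology_def mixed_candidate_def linear_topology_def by auto
  then show "top_dual scl \<gamma> \<subseteq> top_dual scl euclidean" by (intro top_dual_antimono) auto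
  show "topspace \<gamma> = UNIV" by (rule top)
  show "bounded B \<Longrightarrow> subtopology \<tau> B = subtopology \<gamma> B"
    using assms unfolding is_mixed_topology_def mixed_candidate_def by simp
qed

text \<open>A \<open>\<gamma>\<close>-convergent sequence is bounded, and \<open>\<gamma>\<close> agrees with \<open>\<tau>\<close> on bounded sets; hence
  sequential continuity for \<open>\<tau>\<close> on bounded sets is sequential continuity for \<open>\<gamma>\<close>.\<close>

lemma circ_dual_eq_mixed_dual:
  assumes saks: "saks_space scl \<tau>" and mixed: "is_mixed_topology scl \<tau> \<gamma>"
    and mazur: "mazur_space scl \<gamma>"
  shows "circ_dual scl \<tau> = top_dual scl \<gamma>"
proof (intro equalityI subsetI)
  fix f assume f: "f \<in> circ_dual scl \<tau>"
  have "seq_continuous_map \<gamma> f"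
    unfolding seq_continuous_map_def
  proof (intro allI impI)
    fix x l assume "range x \<subseteq> topspace \<gamma> \<and> limitin \<gamma> x l sequentially"
    then have lim: "limitin \<gamma> x l sequentially" by blast
    define B where "B = insert l (range x)"
    have B: "bounded B"
      using mixed_limit_imp_Bseq[OF saks mixed lim] by (simp add: B_def Bseq_eq_bounded)
    have "limitin (subtopology \<gamma> B) x l sequentially"
      using lim unfolding limitin_subtopology B_def by simp
    moreover have "range x \<subseteq> topspace (subtopology \<gamma> B)"
      using mixed_topologyD(1)[OF mixed] by (auto simp: B_def)
    moreover have "seq_continuous_map (subtopology \<gamma> B) f"
      using f B mixed_topologyD(2)[OF mixed B] unfolding circ_dual_def by auto
    ultimately show "(\<lambda>n. f (x n)) \<longlonglongrightarrow> f l" unfolding seq_continuous_map_def by blast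
  qed
  then show "f \<in> top_dual scl \<gamma>"
    using f mazur unfolding mazur_space_def circ_dual_def top_dual_def by auto
next
  fix f assume f: "f \<in> top_dual scl \<gamma>"
  have "seq_continuous_map (subtopology \<tau> B) f" if "bounded B" for B
    unfolding seq_continuous_map_def mixed_topologyD(2)[OF mixed that]
  proof (intro allI impI)
    fix x l
    assume "range x \<subseteq> topspace (subtopology \<gamma> B) \<and> limitin (subtopology \<gamma> B) x l sequentially"
    then have "limitin \<gamma> x l sequentially" by (simp add: limitin_subtopology)
    then have "limitin euclidean (f \<circ> x) (f l) sequentially"
      using f unfolding top_dual_def by (intro continuous_map_limit[of \<gamma>]) auto
    then show "(\<lambda>n. f (x n)) \<longlonglongrightarrow> f l" by (simp add: o_def)
  qed
  then show "f \<in> circ_dual scl \<tau>"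
    using f mixed_topologyD(3)[OF mixed] unfolding circ_dual_def by blast
qed


section \<open>Pointwise and compact convergence of functionals\<close>

text \<open>By uniform boundedness a pointwise Cauchy sequence of functionals lies in a multiple of the
  unit ball, and on the unit ball pointwise Cauchy sequences are uniformly Cauchy on compact
  sets.\<close>

lemma (in banach_space_over) seq_complete_pointwise_iff_compact_conv:
  assumes Y: "Y \<subseteq> top_dual scl euclidean"
    and diff: "\<And>f g. f \<in> Y \<Longrightarrow> g \<in> Y \<Longrightarrow> f - g \<in> Y"
    and mult: "\<And>c f. f \<in> Y \<Longrightarrow> (\<lambda>x. c * f x) \<in> Y"
  shows "seq_complete_on (pointwise_topology Y) (Y \<inter> dual_unit_ball scl) \<longleftrightarrow>
           seq_complete_on (compact_conv_topology Y) Y"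
proof
  assume L: "seq_complete_on (pointwise_topology Y) (Y \<inter> dual_unit_ball scl)"
  show "seq_complete_on (compact_conv_topology Y) Y"
    unfolding seq_complete_on_def
  proof (intro allI impI, elim conjE)
    fix s assume s: "range s \<subseteq> Y" and "tvs_Cauchy (compact_conv_topology Y) s"
    then have unif: "\<And>K. compact K \<Longrightarrow> uniformly_Cauchy_on K s"
      using tvs_Cauchy_compact_conv_topology_iff[OF diff s] by blast
    have Cauchy: "Cauchy (\<lambda>n. s n x)" for x
      using unif[of "{x}"] unfolding uniformly_Cauchy_on_def Cauchy_def by simp
    have bl: "bounded_linear (s n)" for n
      using s Y norm_dual_imp_bounded_linear by blast
    obtain C where C: "C > 0" "\<And>n x. norm (s n x) \<le> C * norm x"
      using uniform_boundedness_sequence[of s, OF bl] Cauchy Cauchy_Bseq by blast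
    define t where "t n = (\<lambda>x. inverse (of_real C) * s n x)" for n
    have tY: "t n \<in> Y" for n using mult s unfolding t_def by blast
    have "norm (t n x) \<le> norm x" for n x
      using C(2)[of n x] C(1) unfolding t_def by (simp add: norm_mult norm_inverse norm_divide field_simps)
    then have "t n \<in> dual_unit_ball scl" for n using tY Y by (intro dual_unit_ballI) auto
    moreover have "Cauchy (\<lambda>n. t n x)" for x
      using Cauchy[of x] unfolding t_def Cauchy_convergent_iff
      by (intro convergent_mult convergent_const)
    then have "tvs_Cauchy (pointwise_topology Y) t"
      using tY by (subst tvs_Cauchy_pointwise_topology_iff[OF diff]) auto
    ultimately obtain l where "l \<in> Y" "limitin (pointwise_topology Y) t l sequentially"
      using L tY unfolding seq_complete_on_def by (metis IntD1 IntI image_subsetI)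
    then have l: "(\<lambda>n. t n x) \<longlonglongrightarrow> l x" for x by (simp add: limitin_pointwise_topology)
    define g where "g = (\<lambda>x. of_real C * l x)"
    have g: "g \<in> Y" unfolding g_def using mult \<open>l \<in> Y\<close> .
    have s_eq: "s n x = of_real C * t n x" for n x using C(1) by (simp add: t_def)
    have lim: "(\<lambda>n. s n x) \<longlonglongrightarrow> g x" for x
      unfolding s_eq g_def by (intro tendsto_mult tendsto_const l)
    have "uniform_limit K s g sequentially" if "compact K" for K
    proof -
      have "uniform_limit K s (\<lambda>x. lim (\<lambda>n. s n x)) sequentially"
        using Cauchy_uniformly_convergent[OF unif[OF that]]
        unfolding uniformly_convergent_uniform_limit_iff .
      then show ?thesis by (simp add: limI[OF lim])
    qed
    then show "\<exists>l\<in>Y. limitin (compact_conv_topology Y) s l sequentially"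
      using g s
      by (intro bexI[of _ g]) (auto simp: limitin_compact_conv_topology image_subset_iff)
  qed
next
  assume R: "seq_complete_on (compact_conv_topology Y) Y"
  show "seq_complete_on (pointwise_topology Y) (Y \<inter> dual_unit_ball scl)"
    unfolding seq_complete_on_def
  proof (intro allI impI, elim conjE)
    fix s assume "range s \<subseteq> Y \<inter> dual_unit_ball scl" and "tvs_Cauchy (pointwise_topology Y) s"
    then have s: "range s \<subseteq> Y" "\<And>n. s n \<in> dual_unit_ball scl"
      and Cauchy: "\<And>x. Cauchy (\<lambda>n. s n x)"
      using tvs_Cauchy_pointwise_topology_iff[of Y s, OF diff] by auto
    have bound: "norm (s n x) \<le> 1 * norm x" for n x using norm_le_of_dual_unit_ball[OF s(2)] by simp
    have "dist (s n x) (s n y) \<le> dist x y" for n x y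
    proof -
      have "bounded_linear (s n)" using s(1) Y norm_dual_imp_bounded_linear by blast
      then have "s n x - s n y = s n (x - y)" by (simp add: linear_simps)
      then show ?thesis using bound[of n "x - y"] by (simp add: dist_norm)
    qed
    then have "uniformly_Cauchy_on K s" if "compact K" for K
      using that Cauchy by (intro uniformly_Cauchy_on_compact)
    then have "tvs_Cauchy (compact_conv_topology Y) s"
      using tvs_Cauchy_compact_conv_topology_iff[OF diff s(1)] by blast
    then obtain l where l: "l \<in> Y" "limitin (compact_conv_topology Y) s l sequentially"
      using R s(1) unfolding seq_complete_on_def by blast
    have "compact {x}" for x :: 'a by simp
    then have "uniform_limit {x} s l sequentially" for x
      using l(2) unfolding limitin_compact_conv_topology by blast
    then have lim: "(\<lambda>n. s n x) \<longlonglongrightarrow> l x" for x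
      by (rule tendsto_uniform_limitI) simp
    have "l \<in> dual_unit_ball scl"
      using pointwise_limit_norm_dual[OF _ bound lim] s(1) Y by (intro dual_unit_ballI) auto
    then show "\<exists>l\<in>Y \<inter> dual_unit_ball scl. limitin (pointwise_topology Y) s l sequentially"
      using l(1) s(1) lim
      by (intro bexI[of _ l]) (auto simp: limitin_pointwise_topology image_subset_iff)
  qed
qed


section \<open>\<open>c\<^sub>0\<close>-barrelled mixed topologies\<close>

text \<open>If \<open>g\<close> were not sequentially continuous, one could choose differences
  \<open>s (n j) - s (m j)\<close> that stay large along a subsequence of a convergent sequence.  These
  differences tend to \<open>0\<close> pointwise, so they are equicontinuous, which is a contradiction.\<close>

lemma c0_barrelled_pointwise_limit_seq_continuous:
  fixes scl :: "'k::{real_normed_field,euclidean_space} \<Rightarrow> 'a::banach \<Rightarrow> 'a"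
  assumes barrelled: "c0_barrelled scl T" and s: "\<And>n. s n \<in> top_dual scl T"
    and lim: "\<And>x. (\<lambda>n. s n x) \<longlonglongrightarrow> g x"
  shows "seq_continuous_map T g"
  unfolding seq_continuous_map_def
proof (intro allI impI, elim conjE)
  fix x l assume "limitin T x l sequentially"
  have claim: "\<exists>N. \<forall>n\<ge>N. \<forall>m\<ge>N. \<forall>k\<ge>N. norm ((s n - s m) (x k) - (s n - s m) l) \<le> e"
    if "e > 0" for e
  proof (rule ccontr)
    assume "\<not> ?thesis"
    then have "\<forall>N. \<exists>n m k. n \<ge> N \<and> m \<ge> N \<and> k \<ge> N \<and> norm ((s n - s m) (x k) - (s n - s m) l) > e"
      by (meson not_le)
    then obtain n m k where N: "\<And>N. n N \<ge> N" "\<And>N. m N \<ge> N" "\<And>N. k N \<ge> N"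
      and large: "\<And>N. norm ((s (n N) - s (m N)) (x (k N)) - (s (n N) - s (m N)) l) > e"
      by metis
    define h where "h j = s (n j) - s (m j)" for j
    have h: "range h \<subseteq> top_dual scl T" unfolding h_def using top_dual_diff[OF s s] by blast
    have "filterlim n at_top sequentially" "filterlim m at_top sequentially"
      using N by (auto intro: filterlim_at_top_mono[OF filterlim_ident])
    then have "(\<lambda>j. h j y) \<longlonglongrightarrow> g y - g y" for y
      unfolding h_def fun_diff_def by (intro tendsto_diff filterlim_compose[OF lim])
    then have "limitin (pointwise_topology (top_dual scl T)) h 0 sequentially"
      using h top_dual_diff[OF s s, of 0 0]
      by (auto simp: limitin_pointwise_topology image_subset_iff)
    then have "equicontinuous_family T (range h)"
      using barrelled h unfolding c0_barrelled_def by blast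
    then obtain U where U: "openin T U" "l \<in> U" "\<And>y j. y \<in> U \<Longrightarrow> dist (h j y) (h j l) < e"
      using \<open>e > 0\<close> limitin_topspace[OF \<open>limitin T x l sequentially\<close>]
      unfolding equicontinuous_family_def by (metis rangeI)
    then obtain M where "\<And>k. k \<ge> M \<Longrightarrow> x k \<in> U"
      using \<open>limitin T x l sequentially\<close> unfolding limitin_def eventually_sequentially by blast
    then have "dist (h M (x (k M))) (h M l) < e" using N(3) U(3) by blast
    then show False using large[of M] unfolding h_def dist_norm by simp
  qed
  show "(\<lambda>n. g (x n)) \<longlonglongrightarrow> g l"
  proof (rule metric_LIMSEQ_I)
    fix e :: real assume "e > 0"
    then obtain N where N: "\<And>m k. m \<ge> N \<Longrightarrow> k \<ge> N \<Longrightarrow>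
        norm ((s N (x k) - s m (x k)) - (s N l - s m l)) \<le> e/2"
      using claim[of "e/2"] by (auto simp: fun_diff_def)
    have close: "norm ((s N (x k) - g (x k)) - (s N l - g l)) \<le> e/2" if "k \<ge> N" for k
    proof (rule Lim_bounded)
      show "(\<lambda>m. norm ((s N (x k) - s m (x k)) - (s N l - s m l)))
          \<longlonglongrightarrow> norm ((s N (x k) - g (x k)) - (s N l - g l))"
        by (intro tendsto_intros lim)
      show "\<forall>m\<ge>N. norm ((s N (x k) - s m (x k)) - (s N l - s m l)) \<le> e/2" using N that by blast
    qed
    have "limitin euclidean (s N \<circ> x) (s N l) sequentially"
      using s[of N] \<open>limitin T x l sequentially\<close> unfolding top_dual_def
      by (intro continuous_map_limit[of T]) auto
    then have "(\<lambda>k. s N (x k)) \<longlonglongrightarrow> s N l" by (simp add: o_def)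
    then obtain M where M: "\<And>k. k \<ge> M \<Longrightarrow> dist (s N (x k)) (s N l) < e/2"
      using \<open>e > 0\<close> metric_LIMSEQ_D[of _ _ "e/2"] by (metis half_gt_zero)
    have "dist (g (x k)) (g l) < e" if "k \<ge> max M N" for k
    proof -
      have "g (x k) - g l = (s N (x k) - s N l) - ((s N (x k) - g (x k)) - (s N l - g l))" by simp
      then have "norm (g (x k) - g l)
          \<le> norm (s N (x k) - s N l) + norm ((s N (x k) - g (x k)) - (s N l - g l))"
        by (metis norm_triangle_ineq4)
      then show ?thesis using close[of k] M[of k] that by (simp add: dist_norm)
    qed
    then show "\<exists>no. \<forall>n\<ge>no. dist (g (x n)) (g l) < e" by blast
  qed
qed

lemma d_consistent_if_c0_barrelled_mazur:
  fixes scl :: "'k::{real_normed_field,euclidean_space} \<Rightarrow> 'a::banach \<Rightarrow> 'a"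
  assumes saks: "saks_space scl \<tau>" and mixed: "is_mixed_topology scl \<tau> \<gamma>"
    and barrelled: "c0_barrelled scl \<gamma>" and mazur: "mazur_space scl \<gamma>"
  shows "d_consistent scl \<tau>"
proof -
  interpret banach_space_over scl using saks unfolding saks_space_def by blast
  let ?Y = "top_dual scl \<gamma>"
  have Y: "?Y \<subseteq> top_dual scl euclidean" by (rule mixed_topologyD(3)[OF mixed])
  have "seq_complete_on (pointwise_topology ?Y) (?Y \<inter> dual_unit_ball scl)"
    unfolding seq_complete_on_def
  proof (intro allI impI, elim conjE)
    fix s assume "range s \<subseteq> ?Y \<inter> dual_unit_ball scl" "tvs_Cauchy (pointwise_topology ?Y) s"
    then have s: "range s \<subseteq> ?Y" "\<And>n. s n \<in> dual_unit_ball scl"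
      and Cauchy: "\<And>x. Cauchy (\<lambda>n. s n x)"
      using tvs_Cauchy_pointwise_topology_iff[of ?Y s, OF top_dual_diff] by auto
    have bound: "norm (s n x) \<le> 1 * norm x" for n x using norm_le_of_dual_unit_ball[OF s(2)] by simp
    define g where "g x = lim (\<lambda>n. s n x)" for x
    have lim: "(\<lambda>n. s n x) \<longlonglongrightarrow> g x" for x
      unfolding g_def using Cauchy by (simp add: Cauchy_convergent_iff convergent_LIMSEQ_iff)
    have g: "g \<in> top_dual scl euclidean" "\<And>x. norm (g x) \<le> 1 * norm x"
      using pointwise_limit_norm_dual[OF _ bound lim] s(1) Y by auto
    have "seq_continuous_map \<gamma> g"
      using barrelled s(1) lim by (intro c0_barrelled_pointwise_limit_seq_continuous) auto
    then have "g \<in> ?Y" using g(1) mazur unfolding top_dual_def mazur_space_def by blast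
    moreover have "g \<in> dual_unit_ball scl" using g by (intro dual_unit_ballI) auto
    ultimately show "\<exists>l\<in>?Y \<inter> dual_unit_ball scl. limitin (pointwise_topology ?Y) s l sequentially"
      using s(1) lim
      by (intro bexI[of _ g]) (auto simp: limitin_pointwise_topology image_subset_iff)
  qed
  moreover have "equicontinuous_family (subtopology \<tau> B) (range f)"
    if f: "range f \<subseteq> ?Y" "limitin (pointwise_topology ?Y) f 0 sequentially" and "bounded B" for f B
    unfolding mixed_topologyD(2)[OF mixed \<open>bounded B\<close>] equicontinuous_family_def
  proof (intro ballI allI impI)
    fix x and e :: real assume x: "x \<in> topspace (subtopology \<gamma> B)" and "e > 0"
    then have "x \<in> topspace \<gamma>" by simp
    have equi: "equicontinuous_family \<gamma> (range f)"
      using barrelled f unfolding c0_barrelled_def by blast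
    have "\<exists>U. openin \<gamma> U \<and> x \<in> U \<and> (\<forall>y\<in>U. \<forall>f\<in>range f. dist (f y) (f x) < e)"
      using equi \<open>x \<in> topspace \<gamma>\<close> \<open>e > 0\<close> unfolding equicontinuous_family_def by simp
    then show "\<exists>U. openin (subtopology \<gamma> B) U \<and> x \<in> U \<and> (\<forall>y\<in>U. \<forall>f\<in>range f. dist (f y) (f x) < e)"
    proof (elim exE conjE)
      fix U assume "openin \<gamma> U" "x \<in> U" "\<forall>y\<in>U. \<forall>f\<in>range f. dist (f y) (f x) < e"
      then show ?thesis using x by (intro exI[of _ "U \<inter> B"]) (auto simp: openin_subtopology)
    qed
  qed
  ultimately show ?thesis
    unfolding d_consistent_def circ_dual_eq_mixed_dual[OF saks mixed mazur] by blast
qed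


section \<open>Mackey spaces\<close>

text \<open>Bounding the partial sums, rather than the sum of the series, makes closedness in the product
  topology visible.\<close>

definition ell1_unit_ball :: "(nat \<Rightarrow> 'k::real_normed_vector) set" where
  "ell1_unit_ball = {a. \<forall>N. (\<Sum>n<N. norm (a n)) \<le> 1}"

lemma summable_norm_ell1_unit_ball:
  assumes "a \<in> ell1_unit_ball" shows "summable (\<lambda>n. norm (a n))"
  using assms unfolding ell1_unit_ball_def by (intro summableI_nonneg_bounded[where x = 1]) auto

lemma summable_ell1_unit_ball_mult:
  fixes a c :: "nat \<Rightarrow> 'k::{real_normed_field,banach}"
  assumes "a \<in> ell1_unit_ball" "Bseq c"
  shows "summable (\<lambda>n. a n * c n)"
proof -
  obtain K where "\<And>n. norm (c n) \<le> K" using assms(2) unfolding Bseq_def by blast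
  then have bound: "norm (a n * c n) \<le> norm (a n) * K" for n
    by (simp add: norm_mult mult_left_mono)
  have "summable (\<lambda>n. norm (a n) * K)"
    using summable_norm_ell1_unit_ball[OF assms(1)] by (rule summable_mult2)
  from this bound show ?thesis by (rule summable_comparison_test')
qed

lemma closed_ell1_unit_ball: "closed (ell1_unit_ball :: (nat \<Rightarrow> 'k::real_normed_vector) set)"
proof -
  have "closed {a :: nat \<Rightarrow> 'k. (\<Sum>n<N. norm (a n)) \<le> 1}" for N
    by (intro closed_Collect_le continuous_intros continuous_on_product_coordinates)
  then have "closed (\<Inter>N. {a :: nat \<Rightarrow> 'k. (\<Sum>n<N. norm (a n)) \<le> 1})" by blast
  moreover have "ell1_unit_ball = (\<Inter>N. {a :: nat \<Rightarrow> 'k. (\<Sum>n<N. norm (a n)) \<le> 1})"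
    unfolding ell1_unit_ball_def by auto
  ultimately show ?thesis by simp
qed

lemma compact_ell1_unit_ball:
  "compact (ell1_unit_ball :: (nat \<Rightarrow> 'k::{real_normed_vector,heine_borel}) set)"
proof -
  let ?C = "PiE UNIV (\<lambda>_. cball 0 1) :: (nat \<Rightarrow> 'k) set"
  have "compactin (product_topology (\<lambda>_. euclidean) UNIV) ?C"
    unfolding compactin_PiE by (simp add: compactin_euclidean_iff)
  then have "compact ?C" by (simp add: euclidean_product_topology compactin_euclidean_iff)
  moreover have "ell1_unit_ball \<subseteq> ?C"
  proof
    fix a :: "nat \<Rightarrow> 'k" assume a: "a \<in> ell1_unit_ball"
    have "norm (a n) \<le> 1" for n
    proof -
      have "norm (a n) \<le> (\<Sum>i<Suc n. norm (a i))" by (rule member_le_sum) auto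
      also have "\<dots> \<le> 1" using a unfolding ell1_unit_ball_def by blast
      finally show ?thesis .
    qed
    then show "a \<in> ?C" by auto
  qed
  ultimately show ?thesis
    using compact_Int_closed[OF _ closed_ell1_unit_ball, of ?C] by (simp add: Int_absorb1)
qed

text \<open>Tails of \<open>\<Sum>n. a n * c n\<close> are small uniformly in \<open>a\<close> because \<open>c\<close> tends to \<open>0\<close>.  This is
  the weak-* continuity of \<open>c\<close>, regarded as an element of \<open>c\<^sub>0\<close>, on the unit ball of its dual.\<close>

lemma continuous_on_ell1_unit_ball_pairing:
  fixes c :: "nat \<Rightarrow> 'k::{real_normed_field,banach}"
  assumes "c \<longlonglongrightarrow> 0"
  shows "continuous_on ell1_unit_ball (\<lambda>a. \<Sum>n. a n * c n)"
proof (rule uniform_limit_theorem)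
  show "\<forall>\<^sub>F N in sequentially. continuous_on ell1_unit_ball (\<lambda>a. \<Sum>n<N. a n * c n)"
    by (intro always_eventually allI continuous_intros
        continuous_on_subset[OF continuous_on_product_coordinates]) auto
  show "uniform_limit ell1_unit_ball (\<lambda>N a. \<Sum>n<N. a n * c n) (\<lambda>a. \<Sum>n. a n * c n) sequentially"
    unfolding uniform_limit_iff
  proof (intro allI impI)
    fix e :: real assume "e > 0"
    then obtain N where N: "\<And>n. n \<ge> N \<Longrightarrow> norm (c n) < e/2"
      using LIMSEQ_D[OF assms, of "e/2"] by auto
    have "dist (\<Sum>n<M. a n * c n) (\<Sum>n. a n * c n) < e" if "M \<ge> N" and a: "a \<in> ell1_unit_ball" for M a
    proof -
      have part: "norm ((\<Sum>n<L. a n * c n) - (\<Sum>n<M. a n * c n)) \<le> e/2" if "L \<ge> M" for L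
      proof -
        have "(\<Sum>n<L. a n * c n) - (\<Sum>n<M. a n * c n) = (\<Sum>n=M..<L. a n * c n)"
          using sum_diff_nat_ivl[of 0 M L "\<lambda>n. a n * c n"] that by (simp add: lessThan_atLeast0)
        also have "norm \<dots> \<le> (\<Sum>n=M..<L. norm (a n) * (e/2))"
        proof (rule sum_norm_le)
          fix n assume "n \<in> {M..<L}"
          then have "norm (c n) \<le> e/2" using N[of n] \<open>M \<ge> N\<close> by simp
          then show "norm (a n * c n) \<le> norm (a n) * (e/2)"
            unfolding norm_mult by (rule mult_left_mono) simp
        qed
        also have "\<dots> = (\<Sum>n=M..<L. norm (a n)) * (e/2)" by (simp add: sum_distrib_right)
        also have "\<dots> \<le> 1 * (e/2)"
        proof (rule mult_right_mono)
          have "(\<Sum>n=M..<L. norm (a n)) \<le> (\<Sum>n<L. norm (a n))" by (rule sum_mono2) auto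
          also have "\<dots> \<le> 1" using a unfolding ell1_unit_ball_def by blast
          finally show "(\<Sum>n=M..<L. norm (a n)) \<le> 1" .
        qed (use \<open>e > 0\<close> in simp)
        finally show ?thesis by simp
      qed
      have "Bseq c" using assms by (intro convergent_imp_Bseq convergentI)
      then have "(\<lambda>L. \<Sum>n<L. a n * c n) \<longlonglongrightarrow> (\<Sum>n. a n * c n)"
        using summable_ell1_unit_ball_mult[OF a] summable_LIMSEQ by blast
      then have "(\<lambda>L. norm ((\<Sum>n<L. a n * c n) - (\<Sum>n<M. a n * c n)))
          \<longlonglongrightarrow> norm ((\<Sum>n. a n * c n) - (\<Sum>n<M. a n * c n))"
        by (intro tendsto_intros)
      then have "norm ((\<Sum>n. a n * c n) - (\<Sum>n<M. a n * c n)) \<le> e/2"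
        by (rule Lim_bounded[where M = M]) (use part in blast)
      then show ?thesis using \<open>e > 0\<close> by (simp add: dist_norm norm_minus_commute)
    qed
    then show "\<forall>\<^sub>F M in sequentially. \<forall>a\<in>ell1_unit_ball. dist (\<Sum>n<M. a n * c n) (\<Sum>n. a n * c n) < e"
      unfolding eventually_sequentially by blast
  qed
qed simp

text \<open>For a pointwise null sequence, this is the pointwise closed absolutely convex hull of its
  members.\<close>

definition ell1_combinations ::
  "(nat \<Rightarrow> 'a \<Rightarrow> 'k::{real_normed_field,banach}) \<Rightarrow> ('a \<Rightarrow> 'k) set" where
  "ell1_combinations f = (\<lambda>a x. \<Sum>n. a n * f n x) ` ell1_unit_ball"

lemma compact_ell1_combinations:
  fixes f :: "nat \<Rightarrow> 'a \<Rightarrow> 'k::{real_normed_field,banach,heine_borel}"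
  assumes "\<And>x. (\<lambda>n. f n x) \<longlonglongrightarrow> 0"
  shows "compact (ell1_combinations f)"
  unfolding ell1_combinations_def
  by (intro compact_continuous_image compact_ell1_unit_ball continuous_on_coordinatewise_then_product
      continuous_on_ell1_unit_ball_pairing assms)

lemma absolutely_convex_ell1_combinations:
  fixes f :: "nat \<Rightarrow> 'a \<Rightarrow> 'k::{real_normed_field,banach}"
  assumes "\<And>x. Bseq (\<lambda>n. f n x)"
  shows "absolutely_convex_functionals (ell1_combinations f)"
  unfolding absolutely_convex_functionals_def
proof (intro ballI allI impI)
  fix g h and \<alpha> \<beta> :: 'k assume "g \<in> ell1_combinations f" "h \<in> ell1_combinations f"
    and \<alpha>\<beta>: "norm \<alpha> + norm \<beta> \<le> 1"
  then obtain a b where a: "a \<in> ell1_unit_ball" "g = (\<lambda>x. \<Sum>n. a n * f n x)"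
    and b: "b \<in> ell1_unit_ball" "h = (\<lambda>x. \<Sum>n. b n * f n x)"
    unfolding ell1_combinations_def by blast
  have "(\<Sum>n<N. norm (\<alpha> * a n + \<beta> * b n)) \<le> 1" for N
  proof -
    have "(\<Sum>n<N. norm (\<alpha> * a n + \<beta> * b n)) \<le> (\<Sum>n<N. norm \<alpha> * norm (a n) + norm \<beta> * norm (b n))"
      by (intro sum_mono) (metis norm_mult norm_triangle_ineq)
    also have "\<dots> = norm \<alpha> * (\<Sum>n<N. norm (a n)) + norm \<beta> * (\<Sum>n<N. norm (b n))"
      by (simp add: sum.distrib sum_distrib_left)
    also have "\<dots> \<le> norm \<alpha> * 1 + norm \<beta> * 1"
      using a(1) b(1) unfolding ell1_unit_ball_def by (intro add_mono mult_left_mono) auto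
    finally show ?thesis using \<alpha>\<beta> by simp
  qed
  then have "(\<lambda>n. \<alpha> * a n + \<beta> * b n) \<in> ell1_unit_ball" unfolding ell1_unit_ball_def by blast
  moreover have "\<alpha> * g x + \<beta> * h x = (\<Sum>n. (\<alpha> * a n + \<beta> * b n) * f n x)" for x
  proof -
    have "summable (\<lambda>n. a n * f n x)" "summable (\<lambda>n. b n * f n x)"
      using summable_ell1_unit_ball_mult a(1) b(1) assms by blast+
    then have "(\<lambda>n. \<alpha> * (a n * f n x) + \<beta> * (b n * f n x)) sums (\<alpha> * g x + \<beta> * h x)"
      unfolding a(2) b(2) by (intro sums_add sums_mult summable_sums)
    then show ?thesis by (simp add: sums_iff algebra_simps)
  qed
  ultimately show "(\<lambda>x. \<alpha> * g x + \<beta> * h x) \<in> ell1_combinations f"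
    unfolding ell1_combinations_def by (intro image_eqI) auto
qed

lemma range_subset_ell1_combinations:
  fixes f :: "nat \<Rightarrow> 'a \<Rightarrow> 'k::{real_normed_field,banach}"
  shows "range f \<subseteq> ell1_combinations f"
proof
  fix g assume "g \<in> range f"
  then obtain m where g: "g = f m" by blast
  define a where "a n = (if n = m then 1 else 0 :: 'k)" for n
  have "(\<Sum>n<N. norm (a n)) \<le> 1" for N
  proof -
    have "(\<Sum>n<N. norm (a n)) = (\<Sum>n<N. if n = m then 1 else 0)" by (intro sum.cong) (auto simp: a_def)
    also have "\<dots> \<le> 1" by simp
    finally show ?thesis .
  qed
  then have "a \<in> ell1_unit_ball" unfolding ell1_unit_ball_def by blast
  moreover have "(\<Sum>n. a n * f n x) = f m x" for x
    using suminf_finite[of "{m}" "\<lambda>n. a n * f n x"] by (simp add: a_def)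
  ultimately show "g \<in> ell1_combinations f"
    unfolding ell1_combinations_def g by (intro image_eqI[of _ _ a]) auto
qed

text \<open>The functions \<open>\<Sum>n. a n * f n\<close> are sequentially continuous for the mixed topology, by
  dominated convergence along a convergent, hence bounded, sequence.  The Mazur property puts
  them into the dual, where they form an absolutely convex weakly compact set, and the Mackey
  topology makes such sets equicontinuous.\<close>

lemma c0_barrelled_if_mackey_mazur:
  fixes scl :: "'k::{real_normed_field,euclidean_space} \<Rightarrow> 'a::banach \<Rightarrow> 'a"
  assumes saks: "saks_space scl \<tau>" and mixed: "is_mixed_topology scl \<tau> \<gamma>"
    and mackey: "mackey_space scl \<gamma>" and mazur: "mazur_space scl \<gamma>"
  shows "c0_barrelled scl \<gamma>"
  unfolding c0_barrelled_def
proof (intro conjI allI impI)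
  show "hausdorff_lcs scl \<gamma>" using mazur unfolding mazur_space_def by blast
  fix f assume "range f \<subseteq> top_dual scl \<gamma> \<and>
    limitin (pointwise_topology (top_dual scl \<gamma>)) f 0 sequentially"
  then have f: "range f \<subseteq> top_dual scl \<gamma>" and null: "(\<lambda>n. f n x) \<longlonglongrightarrow> 0" for x
    by (simp_all add: limitin_pointwise_topology)
  then have Bseq: "Bseq (\<lambda>n. f n x)" for x by (intro convergent_imp_Bseq convergentI)
  interpret banach_space_over scl using saks unfolding saks_space_def by blast
  have lin: "Vector_Spaces.linear scl (*) (f n)" for n using f unfolding top_dual_def by blast
  have "bounded_linear (f n)" for n
    using f mixed_topologyD(3)[OF mixed] norm_dual_imp_bounded_linear by blast
  then obtain C where C: "C > 0" "\<And>n x. norm (f n x) \<le> C * norm x"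
    using uniform_boundedness_sequence[of f] Bseq by blast
  have "ell1_combinations f \<subseteq> top_dual scl \<gamma>"
  proof
    fix g assume "g \<in> ell1_combinations f"
    then obtain a where a: "a \<in> ell1_unit_ball" and g: "g = (\<lambda>x. \<Sum>n. a n * f n x)"
      unfolding ell1_combinations_def by blast
    have summable: "summable (\<lambda>n. a n * f n x)" for x
      using summable_ell1_unit_ball_mult[OF a Bseq] .
    have "g (x + y) = g x + g y" for x y
      using lin suminf_add[OF summable[of x] summable[of y]] unfolding g
      by (simp add: Vector_Spaces.linear_iff distrib_left)
    moreover have "g (scl c x) = c * g x" for c x
      using lin suminf_mult[OF summable[of x], of c] unfolding g
      by (simp add: Vector_Spaces.linear_iff mult.left_commute)
    ultimately have "Vector_Spaces.linear scl (*) g"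
      using lin[of 0] by (simp add: Vector_Spaces.linear_iff)
    moreover have "seq_continuous_map \<gamma> g"
      unfolding seq_continuous_map_def
    proof (intro allI impI, elim conjE)
      fix x l assume lim: "limitin \<gamma> x l sequentially"
      obtain R where R: "\<And>k. norm (x k) \<le> R"
        using mixed_limit_imp_Bseq[OF saks mixed lim] unfolding Bseq_def by blast
      have "norm (a n * f n (x k)) \<le> norm (a n) * (C * R)" for n k
      proof -
        have "norm (f n (x k)) \<le> C * R"
          using C(2)[of n "x k"] mult_left_mono[OF R[of k], of C] C(1) by linarith
        then show ?thesis by (simp add: norm_mult mult_left_mono)
      qed
      moreover have "summable (\<lambda>n. norm (a n) * (C * R))"
        using summable_norm_ell1_unit_ball[OF a] by (rule summable_mult2)
      moreover have "(\<lambda>k. a n * f n (x k)) \<longlonglongrightarrow> a n * f n l" for n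
      proof -
        have "limitin euclidean (f n \<circ> x) (f n l) sequentially"
          using f lim unfolding top_dual_def by (intro continuous_map_limit[of \<gamma>]) auto
        then show ?thesis by (intro tendsto_mult tendsto_const) (simp add: o_def)
      qed
      ultimately show "(\<lambda>k. g (x k)) \<longlonglongrightarrow> g l"
        unfolding g
        using tannerys_theorem[of "\<lambda>n k. a n * f n (x k)" "\<lambda>n. a n * f n l" sequentially
            "\<lambda>n. norm (a n) * (C * R)"]
        by (simp add: case_prod_beta always_eventually)
    qed
    ultimately show "g \<in> top_dual scl \<gamma>" using mazur unfolding mazur_space_def top_dual_def by blast
  qed
  then have "compactin (pointwise_topology (top_dual scl \<gamma>)) (ell1_combinations f)"
    using compact_ell1_combinations[OF null] unfolding pointwise_topology_def
    by (simp add: compactin_subtopology euclidean_product_topology compactin_euclidean_iff)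
  moreover have "absolutely_convex_functionals (ell1_combinations f)"
    using Bseq by (rule absolutely_convex_ell1_combinations)
  ultimately have "openin (mackey_topology (top_dual scl \<gamma>))
      {v \<in> UNIV. \<exists>d<e. \<forall>g\<in>ell1_combinations f. norm (g v - g x) \<le> d}" if "e > 0" for x and e :: real
    unfolding mackey_topology_def uniform_conv_topology_def
    using that by (intro topology_generated_by_Basis) blast
  then have U: "openin \<gamma> {v. \<exists>d<e. \<forall>g\<in>ell1_combinations f. norm (g v - g x) \<le> d}"
    if "e > 0" for x and e :: real
    using mackey that unfolding mackey_space_def by simp
  show "equicontinuous_family \<gamma> (range f)"
    unfolding equicontinuous_family_def
  proof (intro ballI allI impI)
    fix x and e :: real assume "e > 0"
    let ?U = "{v. \<exists>d<e. \<forall>g\<in>ell1_combinations f. norm (g v - g x) \<le> d}"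
    have "x \<in> ?U" using \<open>e > 0\<close> by (auto intro: exI[of _ 0])
    moreover have "dist (g y) (g x) < e" if "y \<in> ?U" "g \<in> range f" for y g
      using that range_subset_ell1_combinations[of f] unfolding dist_norm
      by (auto intro: le_less_trans)
    ultimately show "\<exists>U. openin \<gamma> U \<and> x \<in> U \<and> (\<forall>y\<in>U. \<forall>g\<in>range f. dist (g y) (g x) < e)"
      using U[OF \<open>e > 0\<close>, of x] by blast
  qed
qed


section \<open>Consistency\<close>

theorem theorem3p8:
  fixes scl :: "'k::{real_normed_field,euclidean_space} \<Rightarrow> 'a::banach \<Rightarrow> 'a"
    and \<tau> \<gamma> :: "'a topology"
  assumes saks: "saks_space scl \<tau>"
    and mixed: "is_mixed_topology scl \<tau> \<gamma>"
    and complete: "seq_complete_on \<gamma> UNIV"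
  shows
    "(mazur_space scl \<gamma> \<longrightarrow>
        (seq_complete_on (pointwise_topology (circ_dual scl \<tau>))
           (circ_dual scl \<tau> \<inter> dual_unit_ball scl)
         \<longleftrightarrow>
         seq_complete_on (compact_conv_topology (top_dual scl \<gamma>)) (top_dual scl \<gamma>)))
     \<and> (c0_barrelled scl \<gamma> \<and> mazur_space scl \<gamma> \<longrightarrow> d_consistent scl \<tau>)
     \<and> (mackey_space scl \<gamma> \<and> mazur_space scl \<gamma> \<longrightarrow> d_consistent scl \<tau>)"
proof (intro conjI impI)
  interpret banach_space_over scl using saks unfolding saks_space_def by blast
  assume "mazur_space scl \<gamma>"
  from circ_dual_eq_mixed_dual[OF saks mixed this]
  show "seq_complete_on (pointwise_topology (circ_dual scl \<tau>))
      (circ_dual scl \<tau> \<inter> dual_unit_ball scl) \<longleftrightarrow>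
    seq_complete_on (compact_conv_topology (top_dual scl \<gamma>)) (top_dual scl \<gamma>)"
    using seq_complete_pointwise_iff_compact_conv[OF mixed_topologyD(3)[OF mixed]
        top_dual_diff top_dual_mult] by simp
next
  assume "c0_barrelled scl \<gamma> \<and> mazur_space scl \<gamma>"
  then show "d_consistent scl \<tau>"
    using d_consistent_if_c0_barrelled_mazur[OF saks mixed] by blast
next
  assume "mackey_space scl \<gamma> \<and> mazur_space scl \<gamma>"
  then show "d_consistent scl \<tau>"
    using d_consistent_if_c0_barrelled_mazur[OF saks mixed]
      c0_barrelled_if_mackey_mazur[OF saks mixed] by blast
qed

end
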